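(* Let $\mathbb{F}$ be an arbitrary field, $R=\mathbb{F}[x_1,\dots,x_n]/I$ a finite-dimensional $\mathbb{F}$-algebra, and $m$ an integer with $0\le m\le \dim_{\mathbb{F}}R+1$. There exists an ideal $J_m(R)$ of $\mathbb{F}[h_1,\dots,h_n]$ (where $h_1,\dots,h_n$ are variables, thought of as the coefficients of a general linear form $h(x)=h_1x_1+\dots+h_nx_n$) such that: (1) the zero set $\mathbf{V}_{\mathbb{F}}(J_m(R))\subseteq\mathbb{F}^n$ is exactly the set of $(a_1,\dots,a_n)\in\mathbb{F}^n$ for which the hyperplane $\{a_1x_1+\dots+a_nx_n=0\}$ is $(R,m)$-rich; (2) $J_m(R)$ is either $\langle 0\rangle$ or generated by homogeneous polynomials of degree $\dim_{\mathbb{F}}R-m+1$; (3) for every field extension $\mathbb{E}$ of $\mathbb{F}$, $J_m(R^{\mathbb{E}})=J_m(R)^{\mathbb{E}}$.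
   Context: For an ideal $I$ of $\mathbb{F}[x_1,\dots,x_n]$ and a field extension $\mathbb{E}\supseteq\mathbb{F}$, $I^{\mathbb{E}}$ denotes the ideal of $\mathbb{E}[x_1,\dots,x_n]$ generated by $I$ (similarly for ideals of $\mathbb{F}[h_1,\dots,h_n]$), and $R^{\mathbb{E}}=\mathbb{E}[x_1,\dots,x_n]/I^{\mathbb{E}}$. A linear hyperplane $V$ with equation $a_1x_1+\dots+a_nx_n=0$ is $(R,m)$-rich if $\dim_{\mathbb{F}}\big(\mathbb{F}[x_1,\dots,x_n]/(I+\langle a_1x_1+\dots+a_nx_n\rangle)\big)\ge m$. (The ideal $J_m(R)$ is the same object for both $R$ and $R^{\mathbb{E}}$ constructions, i.e. claim (3) refers to the ideals with properties (1),(2) produced for $R$ and for $R^{\mathbb{E}}$ by the same construction: the ideal generated by the $(N-m+1)$-minors of the matrix of multiplication by $h_1x_1+\dots+h_nx_n$ on $R$, $N=\dim R$.) *)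

theory Defs
  imports
    "HOL-Library.Poly_Mapping"
    "HOL-Algebra.QuotRing"
    "Jordan_Normal_Form.VS_Connect"
    "Jordan_Normal_Form.DL_Submatrix"
begin

text \<open>Polynomials over \<open>'a\<close> in the variables indexed by \<open>'n\<close> are finitely supported maps from
  exponent vectors to coefficients; the library's convolution product makes them a commutative
  ring. The same type serves for the variables \<open>x\<^sub>i\<close> and for the variables \<open>h\<^sub>i\<close>.\<close>

type_synonym ('n, 'a) mpoly = "('n \<Rightarrow>\<^sub>0 nat) \<Rightarrow>\<^sub>0 'a"

definition pconst :: "'a::comm_ring_1 \<Rightarrow> ('n, 'a) mpoly" where
  "pconst c = Poly_Mapping.single 0 c"

definition pvar :: "'n \<Rightarrow> ('n, 'a::comm_ring_1) mpoly" where
  "pvar i = Poly_Mapping.single (Poly_Mapping.single i 1) 1"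

definition peval :: "('n::finite \<Rightarrow> 'a::comm_ring_1) \<Rightarrow> ('n, 'a) mpoly \<Rightarrow> 'a" where
  "peval a p = (\<Sum>e\<in>Poly_Mapping.keys p.
      Poly_Mapping.lookup p e * (\<Prod>i\<in>UNIV. a i ^ Poly_Mapping.lookup e i))"

text \<open>The zero polynomial counts as homogeneous of every degree.\<close>

definition homogeneous_of_degree :: "nat \<Rightarrow> ('n::finite, 'a::comm_ring_1) mpoly \<Rightarrow> bool" where
  "homogeneous_of_degree d p \<longleftrightarrow>
     (\<forall>e\<in>Poly_Mapping.keys p. (\<Sum>i\<in>UNIV. Poly_Mapping.lookup e i) = d)"

definition zero_locus :: "('n::finite, 'a::comm_ring_1) mpoly set \<Rightarrow> ('n \<Rightarrow> 'a) set" where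
  "zero_locus J = {a. \<forall>p\<in>J. peval a p = 0}"

definition lin_form :: "('n::finite \<Rightarrow> 'a::comm_ring_1) \<Rightarrow> ('n, 'a) mpoly" where
  "lin_form a = (\<Sum>i\<in>UNIV. pconst (a i) * pvar i)"

text \<open>\<open>I\<^sup>E\<close> for the field extension given by the embedding \<open>\<phi>\<close>.\<close>

definition extend_ideal ::
    "('a::field \<Rightarrow> 'e::field) \<Rightarrow> ('n, 'a) mpoly set \<Rightarrow> ('n, 'e) mpoly set" where
  "extend_ideal \<phi> I = Idl\<^bsub>class_ring\<^esub> (Poly_Mapping.map \<phi> ` I)"

text \<open>The quotient ring by \<open>I\<close>, with its scalar multiplication by the ground field.\<close>

definition quot_alg :: "('n, 'a::field) mpoly set \<Rightarrow> ('a, ('n, 'a) mpoly set) module" where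
  "quot_alg I = ring.extend (class_ring Quot I)
     \<lparr>smult = (\<lambda>c X. (I +>\<^bsub>class_ring\<^esub> pconst c) \<otimes>\<^bsub>class_ring Quot I\<^esub> X)\<rparr>"

abbreviation quot_fin_dim :: "('n, 'a::field) mpoly set \<Rightarrow> bool" where
  "quot_fin_dim I \<equiv> vectorspace.fin_dim class_ring (quot_alg I)"

abbreviation quot_dim :: "('n, 'a::field) mpoly set \<Rightarrow> nat" where
  "quot_dim I \<equiv> vectorspace.dim class_ring (quot_alg I)"

text \<open>The hyperplane with coefficient vector \<open>a\<close> is \<open>(R, m)\<close>-rich for \<open>R\<close> the quotient by \<open>I\<close>.\<close>

definition rich :: "('n::finite, 'a::field) mpoly set \<Rightarrow> nat \<Rightarrow> ('n \<Rightarrow> 'a) \<Rightarrow> bool" where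
  "rich I m a \<longleftrightarrow>
     m \<le> quot_dim (I <+>\<^bsub>class_ring\<^esub> (Idl\<^bsub>class_ring\<^esub> {lin_form a}))"

definition ordered_basis :: "('n, 'a::field) mpoly set \<Rightarrow> ('n, 'a) mpoly set list \<Rightarrow> bool" where
  "ordered_basis I bs \<longleftrightarrow> distinct bs \<and> vectorspace.basis class_ring (quot_alg I) (set bs)"

text \<open>The matrix of multiplication by (the class of) \<open>f\<close>; column \<open>j\<close> holds the coordinates of
  \<open>f\<close> times the \<open>j\<close>-th basis element.\<close>

definition mult_mat ::
    "('n, 'a::field) mpoly set \<Rightarrow> ('n, 'a) mpoly set list \<Rightarrow> ('n, 'a) mpoly \<Rightarrow> 'a mat" where
  "mult_mat I bs f = (THE A. A \<in> carrier_mat (length bs) (length bs) \<and>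
     (\<forall>j<length bs. (I +>\<^bsub>class_ring\<^esub> f) \<otimes>\<^bsub>quot_alg I\<^esub> bs ! j =
        (\<Oplus>\<^bsub>quot_alg I\<^esub>k\<in>{..<length bs}. A $$ (k, j) \<odot>\<^bsub>quot_alg I\<^esub> bs ! k)))"

text \<open>The matrix of multiplication by the general linear form \<open>\<Sum>\<^sub>i h\<^sub>i x\<^sub>i\<close>, with entries in the
  polynomial ring in the \<open>h\<^sub>i\<close>: the sum of \<open>h\<^sub>i\<close> times the matrix of multiplication by \<open>x\<^sub>i\<close>.\<close>

definition general_mult_mat ::
    "('n::finite, 'a::field) mpoly set \<Rightarrow> ('n, 'a) mpoly set list \<Rightarrow> ('n, 'a) mpoly mat" where
  "general_mult_mat I bs = mat (length bs) (length bs)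
     (\<lambda>(k, j). \<Sum>i\<in>UNIV. pvar i * pconst (mult_mat I bs (pvar i) $$ (k, j)))"

definition minors :: "nat \<Rightarrow> 'r::comm_ring_1 mat \<Rightarrow> 'r set" where
  "minors k A = {det (submatrix A S T) | S T.
     S \<subseteq> {..<dim_row A} \<and> T \<subseteq> {..<dim_col A} \<and> card S = k \<and> card T = k}"

text \<open>\<open>J\<^sub>m(R)\<close>. The ideal of minors does not depend on the basis, so an arbitrary one is chosen.
  There are no \<open>(N + 1)\<close>-minors, hence \<open>m = 0\<close> gives the zero ideal; the only \<open>0\<close>-minor is \<open>1\<close>,
  hence \<open>m = N + 1\<close> gives the unit ideal.\<close>

definition rich_ideal :: "('n::finite, 'a::field) mpoly set \<Rightarrow> nat \<Rightarrow> ('n, 'a) mpoly set" where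
  "rich_ideal I m =
     Idl\<^bsub>class_ring\<^esub> (minors (quot_dim I + 1 - m) (general_mult_mat I (SOME bs. ordered_basis I bs)))"

end

theory Submission
  imports Defs
begin

text \<open>
  Fix polynomials \<open>f\<^sub>0, \<dots>, f\<^sub>N\<^sub>-\<^sub>1\<close> whose classes form a basis of \<open>R\<close>, and let \<open>A\<close> be the matrix of
  multiplication by a linear form \<open>l\<close>. If the \<open>k\<close>-minor of \<open>A\<close> with row set \<open>S\<close> is nonzero, then
  inverting it expresses \<open>f\<^sub>s\<close>, \<open>s \<in> S\<close>, modulo \<open>I + \<langle>l\<rangle>\<close> through the \<open>f\<^sub>u\<close> with \<open>u \<notin> S\<close>, so
  \<open>R / lR\<close> has dimension at most \<open>N - k\<close>. Conversely, pick \<open>U\<close> such that the \<open>f\<^sub>u\<close>, \<open>u \<in> U\<close>, are a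
  basis modulo \<open>I + \<langle>l\<rangle>\<close>; on any set \<open>S\<close> of \<open>k\<close> rows disjoint from \<open>U\<close> the matrix \<open>A\<close> has a right
  inverse, so expanding \<open>det 1 = 1\<close> by multilinearity shows that the \<open>k\<close>-minors of \<open>A\<close> do not all
  vanish. The same expansion shows that ideals of minors shrink under multiplication by matrices,
  hence are independent of the basis. Finally the \<open>E\<close>-linear extensions of the coordinate functionals
  of \<open>R\<close> kill \<open>I\<^sup>E\<close>, so the \<open>f\<^sub>k\<close> remain a basis over \<open>E\<close>, with the same multiplication matrices.
\<close>

section \<open>Polynomials and ideals\<close>

lemma pconst_0 [simp]: "pconst 0 = 0"
  by (simp add: pconst_def)

lemma pconst_1 [simp]: "pconst 1 = 1"
  by (simp add: pconst_def)

lemma pconst_add: "pconst (a + b) = pconst a + pconst b"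
  by (simp add: pconst_def single_add)

lemma pconst_mult: "pconst (a * b) = pconst a * pconst b"
  by (simp add: pconst_def mult_single)

lemma pconst_uminus: "pconst (- a) = - pconst a"
  by (simp add: pconst_def single_uminus)

lemma pconst_diff: "pconst (a - b) = pconst a - pconst b"
  by (simp add: pconst_def single_diff)

lemma pconst_sum: "pconst (\<Sum>i\<in>A. f i) = (\<Sum>i\<in>A. pconst (f i))"
  by (induction A rule: infinite_finite_induct) (simp_all add: pconst_add)

lemma pconst_mult_single:
  "pconst c * Poly_Mapping.single e d = Poly_Mapping.single e (c * d)"
  by (simp add: pconst_def mult_single)

lemma mpoly_sum_monomials:
  "p = (\<Sum>e\<in>Poly_Mapping.keys p.
     pconst (Poly_Mapping.lookup p e) * Poly_Mapping.single e 1)"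
proof (rule poly_mapping_eqI)
  fix k
  show "Poly_Mapping.lookup p k = Poly_Mapping.lookup (\<Sum>e\<in>Poly_Mapping.keys p.
     pconst (Poly_Mapping.lookup p e) * Poly_Mapping.single e 1) k"
    by (simp add: lookup_sum pconst_mult_single lookup_single when_def
        sum.delta in_keys_iff if_distrib cong: if_cong)
qed

lemma mpoly_induct [case_names zero monomial add]:
  fixes p :: "('n, 'a::comm_ring_1) mpoly"
  assumes "P 0" "\<And>e c. P (Poly_Mapping.single e c)" "\<And>p q. P p \<Longrightarrow> P q \<Longrightarrow> P (p + q)"
  shows "P p"
proof -
  have "P (\<Sum>e\<in>A. Poly_Mapping.single e (g e))" if "finite A" for A and g :: "_ \<Rightarrow> 'a"
    using that by (induction A rule: finite_induct) (auto intro: assms)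
  then show ?thesis
    by (subst mpoly_sum_monomials) (simp add: pconst_mult_single)
qed

text \<open>The linear functional with value \<open>u e\<close> on the monomial with exponent
  \<open>e\<close>. A multiplicative \<open>u\<close> gives evaluation at a point; a general
  \<open>u\<close> gives the \<open>E\<close>-linear extension of a coordinate functional of
  \<open>R\<close>.\<close>

definition lin_ext :: "(('n \<Rightarrow>\<^sub>0 nat) \<Rightarrow> 'a) \<Rightarrow> ('n, 'a::comm_ring_1) mpoly \<Rightarrow> 'a" where
  "lin_ext u p = (\<Sum>e\<in>Poly_Mapping.keys p. Poly_Mapping.lookup p e * u e)"

lemma lin_ext_superset:
  assumes "finite A" "Poly_Mapping.keys p \<subseteq> A"
  shows "lin_ext u p = (\<Sum>e\<in>A. Poly_Mapping.lookup p e * u e)"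
  unfolding lin_ext_def
  by (rule sum.mono_neutral_left) (use assms in \<open>auto simp: in_keys_iff\<close>)

lemma lin_ext_add: "lin_ext u (p + q) = lin_ext u p + lin_ext u q"
proof -
  let ?A = "Poly_Mapping.keys p \<union> Poly_Mapping.keys q"
  have "Poly_Mapping.keys (p + q) \<subseteq> ?A" by (rule keys_add)
  then show ?thesis
    by (simp add: lin_ext_superset[of ?A] lookup_add distrib_right sum.distrib)
qed

lemma lin_ext_0 [simp]: "lin_ext u 0 = 0"
  by (simp add: lin_ext_def)

lemma lin_ext_single [simp]: "lin_ext u (Poly_Mapping.single e c) = c * u e"
  by (simp add: lin_ext_def)

lemma lin_ext_sum: "lin_ext u (\<Sum>i\<in>A. f i) = (\<Sum>i\<in>A. lin_ext u (f i))"
  by (induction A rule: infinite_finite_induct) (simp_all add: lin_ext_add)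

lemma lin_ext_pconst_mult: "lin_ext u (pconst c * p) = c * lin_ext u p"
  by (induction p rule: mpoly_induct)
    (simp_all add: pconst_mult_single distrib_left lin_ext_add mult.assoc)

text \<open>By bilinearity, multiplicativity need only be checked on pairs of monomials, hence one
  induction for each factor.\<close>

lemma comm_ring_hom_lin_ext:
  assumes "u 0 = 1" "\<And>e e'. u (e + e') = u e * u e'"
  shows "comm_ring_hom (lin_ext u)"
proof
  have single: "lin_ext u (Poly_Mapping.single e c * q) = c * u e * lin_ext u q" for e c q
    by (induction q rule: mpoly_induct)
      (simp_all add: distrib_left lin_ext_add mult_single assms algebra_simps)
  show "lin_ext u (p * q) = lin_ext u p * lin_ext u q" for p q
    by (induction p rule: mpoly_induct) (simp_all add: distrib_right lin_ext_add single)
  show "lin_ext u 1 = 1"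
    using assms(1) lin_ext_single[of u 0 1] by simp
qed (simp_all add: lin_ext_add)

lemma peval_eq_lin_ext:
  "peval a = lin_ext (\<lambda>e. \<Prod>i\<in>UNIV. a i ^ Poly_Mapping.lookup e i)"
  by (simp add: fun_eq_iff peval_def lin_ext_def)

lemma comm_ring_hom_peval: "comm_ring_hom (peval a)"
  unfolding peval_eq_lin_ext
  by (rule comm_ring_hom_lin_ext) (simp_all add: lookup_add power_add prod.distrib)

lemma peval_pconst [simp]: "peval a (pconst c) = c"
  by (simp add: peval_eq_lin_ext pconst_def)

lemma peval_pvar [simp]: "peval a (pvar i) = a i"
proof -
  have "(\<Prod>j\<in>UNIV. a j ^ Poly_Mapping.lookup (Poly_Mapping.single i 1) j) =
      (\<Prod>j\<in>UNIV. if j = i then a j else 1)"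
    by (rule prod.cong) (auto simp: lookup_single when_def)
  then show ?thesis
    by (simp add: peval_eq_lin_ext pvar_def)
qed

text \<open>\<open>Poly_Mapping.map\<close> puts 0 at every exponent outside the support of
  \<open>p\<close>; the assumption \<open>\<phi> 0 = 0\<close> makes this agree with applying \<phi>
  there.\<close>

lemma lookup_map_hom:
  "\<phi> 0 = 0 \<Longrightarrow> Poly_Mapping.lookup (Poly_Mapping.map \<phi> p) k = \<phi> (Poly_Mapping.lookup p k)"
  by (auto simp: Poly_Mapping.map.rep_eq when_def)

lemma keys_map_subset: "Poly_Mapping.keys (Poly_Mapping.map \<phi> p) \<subseteq> Poly_Mapping.keys p"
  by (auto simp: in_keys_iff Poly_Mapping.map.rep_eq when_def split: if_splits)

lemma comm_ring_hom_map:
  fixes \<phi> :: "'a::comm_ring_1 \<Rightarrow> 'e::comm_ring_1"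
  assumes "comm_ring_hom \<phi>"
  shows "comm_ring_hom (Poly_Mapping.map \<phi> :: ('n, 'a) mpoly \<Rightarrow> ('n, 'e) mpoly)"
proof -
  interpret comm_ring_hom \<phi> by fact
  let ?h = "Poly_Mapping.map \<phi> :: ('n, 'a) mpoly \<Rightarrow> ('n, 'e) mpoly"
  have add: "?h (p + q) = ?h p + ?h q" for p q
    by (rule poly_mapping_eqI) (simp add: lookup_map_hom lookup_add hom_distribs)
  have zero: "?h 0 = 0"
    by (simp add: map_eq_zero_iff)
  have single: "?h (Poly_Mapping.single e c * q) = ?h (Poly_Mapping.single e c) * ?h q" for e c q
    by (induction q rule: mpoly_induct)
      (simp_all add: distrib_left add zero mult_single hom_distribs)
  show ?thesis
  proof
    show "?h (p * q) = ?h p * ?h q" for p q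
      by (induction p rule: mpoly_induct) (simp_all add: distrib_right add zero single del: map_single)
    show "?h 1 = 1"
      by (simp flip: single_one)
  qed (simp_all add: add zero)
qed

lemma map_pconst: "\<phi> 0 = 0 \<Longrightarrow> Poly_Mapping.map \<phi> (pconst c) = pconst (\<phi> c)"
  by (simp add: pconst_def)

lemma map_pvar: "\<phi> 0 = 0 \<Longrightarrow> \<phi> 1 = 1 \<Longrightarrow> Poly_Mapping.map \<phi> (pvar i) = pvar i"
  by (simp add: pvar_def)

section \<open>Homogeneous polynomials\<close>

lemma homogeneous_of_degree_add:
  "homogeneous_of_degree d p \<Longrightarrow> homogeneous_of_degree d q \<Longrightarrow> homogeneous_of_degree d (p + q)"
  unfolding homogeneous_of_degree_def using keys_add[of p q] by blast

lemma homogeneous_of_degree_0: "homogeneous_of_degree d 0"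
  by (simp add: homogeneous_of_degree_def)

lemma homogeneous_of_degree_sum:
  "(\<And>i. i \<in> A \<Longrightarrow> homogeneous_of_degree d (f i)) \<Longrightarrow> homogeneous_of_degree d (\<Sum>i\<in>A. f i)"
  by (induction A rule: infinite_finite_induct)
    (simp_all add: homogeneous_of_degree_0 homogeneous_of_degree_add)

lemma homogeneous_of_degree_mult:
  "homogeneous_of_degree d p \<Longrightarrow> homogeneous_of_degree d' q \<Longrightarrow>
    homogeneous_of_degree (d + d') (p * q)"
  unfolding homogeneous_of_degree_def using keys_mult[of p q]
  by (fastforce simp: lookup_add sum.distrib)

lemma homogeneous_of_degree_1: "homogeneous_of_degree 0 1"
  by (simp add: homogeneous_of_degree_def)

lemma homogeneous_of_degree_pconst: "homogeneous_of_degree 0 (pconst c)"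
  by (simp add: homogeneous_of_degree_def pconst_def)

lemma homogeneous_of_degree_pvar: "homogeneous_of_degree 1 (pvar i)"
  by (simp add: homogeneous_of_degree_def pvar_def lookup_single when_def)

lemma homogeneous_of_degree_prod:
  "finite A \<Longrightarrow> (\<And>i. i \<in> A \<Longrightarrow> homogeneous_of_degree 1 (f i)) \<Longrightarrow>
    homogeneous_of_degree (card A) (\<Prod>i\<in>A. f i)"
proof (induction A rule: finite_induct)
  case (insert x A)
  then show ?case
    using homogeneous_of_degree_mult[of 1 "f x" "card A" "\<Prod>i\<in>A. f i"] by simp
qed (simp add: homogeneous_of_degree_1)

text \<open>Each term of the Leibniz formula is a sign, of degree 0, times a product of
  \<open>k\<close> linear entries.\<close>

lemma homogeneous_of_degree_det:
  fixes A :: "('n::finite, 'a::comm_ring_1) mpoly mat"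
  assumes "A \<in> carrier_mat k k"
    and "\<And>i j. i < k \<Longrightarrow> j < k \<Longrightarrow> homogeneous_of_degree 1 (A $$ (i, j))"
  shows "homogeneous_of_degree k (det A)"
  unfolding det_def'[OF assms(1)]
proof (rule homogeneous_of_degree_sum)
  fix p assume "p \<in> {p. p permutes {0..<k}}"
  then have p: "p permutes {0..<k}" by simp
  have "homogeneous_of_degree k (\<Prod>i = 0..<k. A $$ (i, p i))"
    using homogeneous_of_degree_prod[of "{0..<k}" "\<lambda>i. A $$ (i, p i)"]
      permutes_in_image[OF p] assms(2) by simp
  moreover have "homogeneous_of_degree 0 (signof p :: ('n, 'a) mpoly)"
    by (simp add: homogeneous_of_degree_def sign_def)
  ultimately show "homogeneous_of_degree k (signof p * (\<Prod>i = 0..<k. A $$ (i, p i)))"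
    using homogeneous_of_degree_mult[of 0 _ k] by fastforce
qed

section \<open>Ideals, generated ideals and zero loci\<close>

lemma ideal_class_ring_iff:
  fixes I :: "'r::comm_ring_1 set"
  shows "ideal I class_ring \<longleftrightarrow>
    0 \<in> I \<and> (\<forall>a\<in>I. \<forall>b\<in>I. a + b \<in> I) \<and> (\<forall>r. \<forall>a\<in>I. r * a \<in> I)" (is "?L \<longleftrightarrow> ?R")
proof
  assume ?L
  interpret ideal I class_ring by fact
  show ?R
    using zero_closed a_closed I_l_closed by simp
next
  assume R: ?R
  have uminus: "- a \<in> I" if "a \<in> I" for a
    using R that by (metis mult_minus1)
  have "subgroup I (add_monoid class_ring)"
  proof
    fix a assume "a \<in> I"
    then show "inv\<^bsub>add_monoid class_ring\<^esub> a \<in> I"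
      using uminus class_ring_simps(8) unfolding a_inv_def by metis
  qed (use R in auto)
  then show ?L
    by (intro idealI class_ring.ring_axioms)
      (use R in \<open>simp_all, metis mult.commute\<close>)
qed

context
  fixes I :: "'r::comm_ring_1 set"
  assumes I: "ideal I class_ring"
begin

lemma ideal_0: "0 \<in> I"
  and ideal_add: "a \<in> I \<Longrightarrow> b \<in> I \<Longrightarrow> a + b \<in> I"
  and ideal_mult: "a \<in> I \<Longrightarrow> r * a \<in> I"
  using I by (auto simp: ideal_class_ring_iff)

lemma ideal_uminus: "a \<in> I \<Longrightarrow> - a \<in> I"
  using ideal_mult[of a "- 1"] by simp

lemma ideal_diff: "a \<in> I \<Longrightarrow> b \<in> I \<Longrightarrow> a - b \<in> I"
  using ideal_add[of a "- b"] ideal_uminus[of b] by simp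

lemma ideal_sum: "(\<And>i. i \<in> A \<Longrightarrow> f i \<in> I) \<Longrightarrow> (\<Sum>i\<in>A. f i) \<in> I"
  by (induction A rule: infinite_finite_induct) (simp_all add: ideal_0 ideal_add)

end

lemma ideal_Idl: "ideal (Idl\<^bsub>class_ring\<^esub> S) (class_ring :: 'r::comm_ring_1 ring)"
  by (rule ring.genideal_ideal[OF class_ring.ring_axioms]) simp

lemma Idl_superset: "S \<subseteq> Idl\<^bsub>class_ring\<^esub> (S :: 'r::comm_ring_1 set)"
  by (rule ring.genideal_self[OF class_ring.ring_axioms]) simp

lemma Idl_least:
  "ideal I class_ring \<Longrightarrow> S \<subseteq> I \<Longrightarrow> Idl\<^bsub>class_ring\<^esub> S \<subseteq> (I :: 'r::comm_ring_1 set)"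
  by (rule ring.genideal_minimal[OF class_ring.ring_axioms])

lemma ideal_vimage_hom:
  assumes "comm_ring_hom h" "ideal J class_ring"
  shows "ideal (h -` J) class_ring"
proof -
  interpret comm_ring_hom h by fact
  show ?thesis
    using assms(2) by (auto simp: ideal_class_ring_iff hom_distribs)
qed

lemma Idl_image_hom:
  assumes "comm_ring_hom h"
  shows "Idl\<^bsub>class_ring\<^esub> (h ` (Idl\<^bsub>class_ring\<^esub> S)) = Idl\<^bsub>class_ring\<^esub> (h ` S)"
proof
  have "Idl\<^bsub>class_ring\<^esub> S \<subseteq> h -` (Idl\<^bsub>class_ring\<^esub> (h ` S))"
    using Idl_superset[of "h ` S"] by (intro Idl_least ideal_vimage_hom assms ideal_Idl) auto
  then show "Idl\<^bsub>class_ring\<^esub> (h ` (Idl\<^bsub>class_ring\<^esub> S)) \<subseteq> Idl\<^bsub>class_ring\<^esub> (h ` S)"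
    by (intro Idl_least ideal_Idl) auto
  show "Idl\<^bsub>class_ring\<^esub> (h ` S) \<subseteq> Idl\<^bsub>class_ring\<^esub> (h ` (Idl\<^bsub>class_ring\<^esub> S))"
    using Idl_superset[of S] Idl_superset[of "h ` (Idl\<^bsub>class_ring\<^esub> S)"]
    by (intro Idl_least ideal_Idl) blast
qed

text \<open>The polynomials vanishing at a fixed point form an ideal, the preimage of
  \<open>{0}\<close> under evaluation, so it suffices to test generators.\<close>

lemma zero_locus_Idl: "zero_locus (Idl\<^bsub>class_ring\<^esub> S) = zero_locus S"
proof -
  have "(\<forall>p\<in>Idl\<^bsub>class_ring\<^esub> S. peval a p = 0) \<longleftrightarrow> (\<forall>p\<in>S. peval a p = 0)" for a :: "'a \<Rightarrow> 'b"
  proof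
    assume "\<forall>p\<in>S. peval a p = 0"
    moreover have "ideal {0 :: 'b} class_ring"
      by (simp add: ideal_class_ring_iff)
    ultimately have "Idl\<^bsub>class_ring\<^esub> S \<subseteq> peval a -` {0}"
      by (intro Idl_least ideal_vimage_hom comm_ring_hom_peval) auto
    then show "\<forall>p\<in>Idl\<^bsub>class_ring\<^esub> S. peval a p = 0" by auto
  qed (use Idl_superset in blast)
  then show ?thesis by (simp add: zero_locus_def)
qed

section \<open>Ideals of minors\<close>

text \<open>Index functions replace index sets because the multilinear expansion of a determinant
  produces arbitrary functions, unordered and with repetitions. \<open>minor_mem_Idl\<close> leads
  back to sets.\<close>

definition minor :: "nat \<Rightarrow> 'r::comm_ring_1 mat \<Rightarrow> (nat \<Rightarrow> nat) \<Rightarrow> (nat \<Rightarrow> nat) \<Rightarrow> 'r" where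
  "minor k A s t = det (mat k k (\<lambda>(i, j). A $$ (s i, t j)))"

lemma det_mat_transpose:
  "det (mat k k (\<lambda>(i, j). g j i)) = det (mat k k (\<lambda>(i, j). g i j))"
proof -
  have "mat k k (\<lambda>(i, j). g j i) = transpose_mat (mat k k (\<lambda>(i, j). g i j))"
    by (rule eq_matI) auto
  then show ?thesis by (simp add: det_transpose[of _ k])
qed

lemma minor_transpose:
  assumes "\<And>i. i < k \<Longrightarrow> s i < dim_col A" "\<And>i. i < k \<Longrightarrow> t i < dim_row A"
  shows "minor k (transpose_mat A) s t = minor k A t s"
proof -
  have "minor k (transpose_mat A) s t = det (mat k k (\<lambda>(i, j). A $$ (t j, s i)))"
    unfolding minor_def by (rule arg_cong[of _ _ det], rule eq_matI) (auto simp: assms)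
  then show ?thesis
    unfolding minor_def by (simp add: det_mat_transpose[of k "\<lambda>i j. A $$ (t i, s j)"])
qed

lemma det_submatrix_eq_minor:
  assumes "S \<subseteq> {..<dim_row A}" "T \<subseteq> {..<dim_col A}" "card S = k" "card T = k"
  shows "det (submatrix A S T) = minor k A (pick S) (pick T)"
proof -
  have "{i. i < dim_row A \<and> i \<in> S} = S" "{i. i < dim_col A \<and> i \<in> T} = T"
    using assms by auto
  then show ?thesis
    by (simp add: submatrix_def minor_def assms)
qed

lemma pick_less:
  assumes "S \<subseteq> {..<n}" "i < card S"
  shows "pick S i < n"
  using assms pick_in_set_le by blast

text \<open>\<open>pick S\<close> enumerates \<open>S\<close> in increasing order, hence is
  injective; counting gives surjectivity.\<close>

lemma bij_betw_pick:
  assumes "finite S"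
  shows "bij_betw (pick S) {..<card S} S"
proof -
  have inj: "inj_on (pick S) {..<card S}"
    by (rule linorder_inj_onI) (use pick_mono_le in fastforce)+
  moreover have "pick S ` {..<card S} \<subseteq> S"
    using pick_in_set_le by auto
  ultimately show ?thesis
    using card_subset_eq[OF assms] by (simp add: bij_betw_def card_image)
qed

lemma pick_surj:
  assumes "finite S" "x \<in> S"
  obtains i where "i < card S" "pick S i = x"
  using bij_betw_imp_surj_on[OF bij_betw_pick[OF assms(1)]] assms(2)
  by (metis imageE lessThan_iff)

lemma pick_eq_iff:
  assumes "finite S" "i < card S" "j < card S"
  shows "pick S i = pick S j \<longleftrightarrow> i = j"
  using inj_on_eq_iff[OF bij_betw_imp_inj_on[OF bij_betw_pick[OF assms(1)]]] assms(2,3) by simp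

lemma minors_eq:
  "minors k A = {minor k A (pick S) (pick T) | S T.
     S \<subseteq> {..<dim_row A} \<and> T \<subseteq> {..<dim_col A} \<and> card S = k \<and> card T = k}"
  unfolding minors_def by (metis (no_types, opaque_lifting) det_submatrix_eq_minor)

text \<open>A repeated index gives two equal rows, so the determinant is 0. Otherwise
  \<open>s\<close> is a permutation followed by the increasing enumeration of its image, and
  \<open>c\<close> is the sign of that permutation.\<close>

lemma det_reindex_rows:
  fixes g :: "nat \<Rightarrow> nat \<Rightarrow> 'r::comm_ring_1"
  shows "det (mat k k (\<lambda>(i, j). g (s i) j)) = 0 \<or>
    card (s ` {..<k}) = k \<and>
    (\<exists>c. det (mat k k (\<lambda>(i, j). g (s i) j)) =
       c * det (mat k k (\<lambda>(i, j). g (pick (s ` {..<k}) i) j)))"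
proof (cases "inj_on s {..<k}")
  case False
  then obtain i i' where ii: "i < k" "i' < k" "i \<noteq> i'" "s i = s i'"
    by (auto simp: inj_on_def)
  have "det (mat k k (\<lambda>(i, j). g (s i) j)) = 0"
    by (rule det_identical_rows[of _ k i i']) (use ii in \<open>auto intro!: eq_vecI\<close>)
  then show ?thesis by simp
next
  case True
  define S where "S = s ` {..<k}"
  have card: "card S = k" using True by (simp add: S_def card_image)
  have "bij_betw (pick S) {..<k} S"
    using bij_betw_pick[of S] by (simp add: card) (simp add: S_def)
  \<comment> \<open>The permutation with \<open>pick S (p i) = s i\<close> for \<open>i < k\<close>,
    continued by the identity as \<open>permutes\<close> demands.\<close>
  define p where "p i = (if i < k then inv_into {..<k} (pick S) (s i) else i)" for i
  have pick_p: "pick S (p i) = s i" if "i < k" for i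
    using that \<open>bij_betw (pick S) {..<k} S\<close>
    by (simp add: p_def S_def bij_betw_inv_into_right)
  have "bij_betw (inv_into {..<k} (pick S) \<circ> s) {..<k} {..<k}"
    using bij_betw_trans[OF _ bij_betw_inv_into[OF \<open>bij_betw (pick S) {..<k} S\<close>], of s "{..<k}"] True
    by (simp add: bij_betw_def S_def)
  then have "bij_betw p {..<k} {..<k}"
    by (subst bij_betw_cong[of _ _ "inv_into {..<k} (pick S) \<circ> s"]) (auto simp: p_def)
  then have perm: "p permutes {0..<k}"
    by (intro bij_imp_permutes) (auto simp: p_def atLeast0LessThan)
  let ?B = "mat k k (\<lambda>(i, j). g (pick S i) j)"
  have "mat k k (\<lambda>(i, j). g (s i) j) = mat k k (\<lambda>(i, j). ?B $$ (p i, j))"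
    by (rule eq_matI) (use permutes_in_image[OF perm] pick_p in auto)
  then have "det (mat k k (\<lambda>(i, j). g (s i) j)) = signof p * det ?B"
    using det_permute_rows[OF _ perm, of ?B] by simp
  then show ?thesis using card by (auto simp: S_def)
qed

text \<open>\<open>det_reindex_rows\<close> is applied to the rows and then, after transposing, to
  the columns. What remains is a multiple of a genuine minor.\<close>

lemma minor_mem_Idl:
  assumes "\<And>i. i < k \<Longrightarrow> s i < dim_row A" "\<And>i. i < k \<Longrightarrow> t i < dim_col A"
  shows "minor k A s t \<in> Idl\<^bsub>class_ring\<^esub> (minors k A)"
proof (cases "minor k A s t = 0")
  case True
  then show ?thesis by (simp add: ideal_0[OF ideal_Idl])
next
  case False
  define S where "S = s ` {..<k}"
  define T where "T = t ` {..<k}"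
  from False det_reindex_rows[of k "\<lambda>a j. A $$ (a, t j)" s] obtain c
    where S: "card S = k" and c: "minor k A s t = c * minor k A (pick S) t"
    by (auto simp: minor_def S_def)
  have eq: "minor k A (pick S) t' = det (mat k k (\<lambda>(i, j). A $$ (pick S j, t' i)))" for t'
    unfolding minor_def
    by (rule det_mat_transpose[of k "\<lambda>i j. A $$ (pick S j, t' i)"])
  have "minor k A (pick S) t \<noteq> 0" using False c by auto
  with det_reindex_rows[of k "\<lambda>a j. A $$ (pick S j, a)" t] obtain d
    where T: "card T = k" and d: "minor k A (pick S) t = d * minor k A (pick S) (pick T)"
    by (auto simp: eq T_def)
  have "minor k A (pick S) (pick T) \<in> minors k A"
    unfolding minors_eq using S T assms by (auto simp: S_def T_def)
  then show ?thesis
    unfolding c d by (intro ideal_mult[OF ideal_Idl]) (use Idl_superset in blast)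
qed

text \<open>Multilinearity in the rows: in the Leibniz formula the product of sums is expanded over
  all choices \<open>f\<close> of a summand in each row, and the two summations are exchanged.
  Grouping the \<open>f\<close> by their image would give the Cauchy-Binet formula.\<close>

lemma det_mat_sum_rows:
  fixes X g :: "nat \<Rightarrow> nat \<Rightarrow> 'r::comm_ring_1"
  shows "det (mat k k (\<lambda>(i, j). \<Sum>l<n. X i l * g l j)) =
    (\<Sum>f\<in>{0..<k} \<rightarrow>\<^sub>E {..<n}. (\<Prod>i = 0..<k. X i (f i)) * det (mat k k (\<lambda>(i, j). g (f i) j)))"
    (is "?L = ?R")
proof -
  have "?L = (\<Sum>p | p permutes {0..<k}. signof p * (\<Prod>i = 0..<k. \<Sum>l<n. X i l * g l (p i)))"
    by (subst det_def'[of _ k]) (auto intro!: sum.cong prod.cong simp: permutes_in_image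
      [of _ "{0..<k}", unfolded atLeastLessThan_iff, simplified])
  also have "\<dots> = (\<Sum>p | p permutes {0..<k}. \<Sum>f\<in>{0..<k} \<rightarrow>\<^sub>E {..<n}.
      signof p * (\<Prod>i = 0..<k. X i (f i) * g (f i) (p i)))"
    by (simp add: prod_sum_PiE sum_distrib_left)
  also have "\<dots> = (\<Sum>f\<in>{0..<k} \<rightarrow>\<^sub>E {..<n}. (\<Prod>i = 0..<k. X i (f i)) *
      (\<Sum>p | p permutes {0..<k}. signof p * (\<Prod>i = 0..<k. g (f i) (p i))))"
    by (subst sum.swap) (simp add: prod.distrib sum_distrib_left algebra_simps)
  also have "\<dots> = ?R"
    by (subst det_def'[of _ k]) (auto intro!: sum.cong prod.cong arg_cong2[of _ _ _ _ "(*)"]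
      simp: permutes_in_image[of _ "{0..<k}", unfolded atLeastLessThan_iff, simplified])
  finally show ?thesis .
qed

text \<open>Every row is a linear combination of rows of \<open>B\<close>, so each term of the
  expansion is a multiple of a minor of \<open>B\<close> with row indices \<open>f\<close>.\<close>

lemma det_mult_rows_mem_Idl_minors:
  fixes B :: "'r::comm_ring_1 mat"
  assumes "\<And>j. j < k \<Longrightarrow> t j < dim_col B"
  shows "det (mat k k (\<lambda>(i, j). \<Sum>l<dim_row B. X i l * B $$ (l, t j)))
    \<in> Idl\<^bsub>class_ring\<^esub> (minors k B)"
  unfolding det_mat_sum_rows[of k X "\<lambda>l j. B $$ (l, t j)" "dim_row B"]
proof (intro ideal_sum[OF ideal_Idl] ideal_mult[OF ideal_Idl])
  fix f assume "f \<in> {0..<k} \<rightarrow>\<^sub>E {..<dim_row B}"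
  then show "det (mat k k (\<lambda>(i, j). B $$ (f i, t j))) \<in> Idl\<^bsub>class_ring\<^esub> (minors k B)"
    using minor_mem_Idl[of k f B t] assms by (auto simp: minor_def PiE_def Pi_def)
qed

lemma Idl_minors_transpose_subset:
  "Idl\<^bsub>class_ring\<^esub> (minors k (transpose_mat A)) \<subseteq> Idl\<^bsub>class_ring\<^esub> (minors k A)"
proof (intro Idl_least ideal_Idl subsetI)
  fix x assume "x \<in> minors k (transpose_mat A)"
  then obtain S T where "S \<subseteq> {..<dim_col A}" "T \<subseteq> {..<dim_row A}" "card S = k" "card T = k"
    "x = minor k (transpose_mat A) (pick S) (pick T)"
    by (auto simp: minors_eq)
  then show "x \<in> Idl\<^bsub>class_ring\<^esub> (minors k A)"
    by (auto simp: minor_transpose pick_less intro!: minor_mem_Idl)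
qed

lemma Idl_minors_transpose:
  "Idl\<^bsub>class_ring\<^esub> (minors k (transpose_mat A)) = Idl\<^bsub>class_ring\<^esub> (minors k A)"
  using Idl_minors_transpose_subset[of k A] Idl_minors_transpose_subset[of k "transpose_mat A"]
  by auto

lemma det_mult_cols_mem_Idl_minors:
  fixes B :: "'r::comm_ring_1 mat"
  assumes "\<And>i. i < k \<Longrightarrow> s i < dim_row B"
  shows "det (mat k k (\<lambda>(i, j). \<Sum>l<dim_col B. B $$ (s i, l) * X l j))
    \<in> Idl\<^bsub>class_ring\<^esub> (minors k B)"
proof -
  have "mat k k (\<lambda>(j, i). \<Sum>l<dim_col B. B $$ (s i, l) * X l j) = mat k k
      (\<lambda>(i, j). \<Sum>l<dim_row (transpose_mat B). X l i * transpose_mat B $$ (l, s j))"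
    by (rule eq_matI) (auto simp: assms mult.commute intro!: sum.cong)
  moreover have "det (mat k k (\<lambda>(i, j). \<Sum>l<dim_col B. B $$ (s i, l) * X l j)) =
      det (mat k k (\<lambda>(j, i). \<Sum>l<dim_col B. B $$ (s i, l) * X l j))"
    by (rule det_mat_transpose)
  ultimately show ?thesis
    using det_mult_rows_mem_Idl_minors[of k s "transpose_mat B" "\<lambda>i l. X l i"] assms
    by (simp add: Idl_minors_transpose)
qed

text \<open>The rows of \<open>A * B\<close> are linear combinations of the rows of
  \<open>B\<close>.\<close>

lemma Idl_minors_mult_left:
  assumes "A \<in> carrier_mat a b" "B \<in> carrier_mat b c"
  shows "Idl\<^bsub>class_ring\<^esub> (minors k (A * B)) \<subseteq> Idl\<^bsub>class_ring\<^esub> (minors k B)"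
proof (intro Idl_least ideal_Idl subsetI)
  fix x assume "x \<in> minors k (A * B)"
  then obtain S T where ST: "S \<subseteq> {..<a}" "T \<subseteq> {..<c}" "card S = k" "card T = k"
    "x = minor k (A * B) (pick S) (pick T)"
    using assms by (auto simp: minors_eq)
  then have "x = det (mat k k (\<lambda>(i, j). \<Sum>l<dim_row B. A $$ (pick S i, l) * B $$ (l, pick T j)))"
    unfolding minor_def ST(5) using assms
    by (intro arg_cong[of _ _ det] eq_matI)
      (auto simp: pick_less scalar_prod_def atLeast0LessThan)
  then show "x \<in> Idl\<^bsub>class_ring\<^esub> (minors k B)"
    using det_mult_rows_mem_Idl_minors[of k "pick T" B] ST assms by (auto simp: pick_less)
qed

lemma Idl_minors_mult_right:
  assumes "A \<in> carrier_mat a b" "B \<in> carrier_mat b c"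
  shows "Idl\<^bsub>class_ring\<^esub> (minors k (A * B)) \<subseteq> Idl\<^bsub>class_ring\<^esub> (minors k A)"
proof -
  have "Idl\<^bsub>class_ring\<^esub> (minors k (A * B)) = Idl\<^bsub>class_ring\<^esub> (minors k (B\<^sup>T * A\<^sup>T))"
    using Idl_minors_transpose[of k "A * B"] transpose_mult[OF assms] by simp
  also have "\<dots> \<subseteq> Idl\<^bsub>class_ring\<^esub> (minors k (A\<^sup>T))"
    by (rule Idl_minors_mult_left[of _ c b _ a]) (use assms in auto)
  finally show ?thesis by (simp add: Idl_minors_transpose)
qed

text \<open>Determinants commute with ring homomorphisms. This serves both evaluation at a point and
  extension of scalars.\<close>

lemma minors_map_mat:
  assumes "comm_ring_hom h"
  shows "minors k (map_mat h A) = h ` minors k A"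
proof -
  interpret comm_ring_hom h by fact
  have "minor k (map_mat h A) (pick S) (pick T) = h (minor k A (pick S) (pick T))"
    if "S \<subseteq> {..<dim_row A}" "T \<subseteq> {..<dim_col A}" "card S = k" "card T = k" for S T
    unfolding minor_def hom_det[symmetric] using that
    by (intro arg_cong[of _ _ det] eq_matI) (auto simp: pick_less)
  then show ?thesis
    unfolding minors_eq by (auto simp: image_def) metis+
qed

lemma homogeneous_minors:
  assumes "p \<in> minors k A"
    and "\<And>i j. i < dim_row A \<Longrightarrow> j < dim_col A \<Longrightarrow> homogeneous_of_degree 1 (A $$ (i, j))"
  shows "homogeneous_of_degree k p"
proof -
  from assms(1) obtain S T where ST: "S \<subseteq> {..<dim_row A}" "T \<subseteq> {..<dim_col A}"
    "card S = k" "card T = k" "p = minor k A (pick S) (pick T)"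
    by (auto simp: minors_eq)
  show ?thesis
    unfolding ST(5) minor_def
    by (rule homogeneous_of_degree_det) (use ST assms(2) in \<open>auto simp: pick_less\<close>)
qed

section \<open>Bases of the quotient algebra\<close>

text \<open>\<open>c\<close> is a coordinate vector of the class of \<open>p\<close>. Linear algebra
  is done with families of polynomials modulo an ideal rather than with cosets, so that one family
  \<open>f\<close> can be considered modulo several ideals.\<close>

definition represents ::
    "('n, 'a::field) mpoly set \<Rightarrow> 'k set \<Rightarrow> ('k \<Rightarrow> ('n, 'a) mpoly) \<Rightarrow>
     ('n, 'a) mpoly \<Rightarrow> ('k \<Rightarrow> 'a) \<Rightarrow> bool" where
  "represents I K f p c \<longleftrightarrow> p - (\<Sum>k\<in>K. pconst (c k) * f k) \<in> I"

definition spans_mod ::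
    "('n, 'a::field) mpoly set \<Rightarrow> 'k set \<Rightarrow> ('k \<Rightarrow> ('n, 'a) mpoly) \<Rightarrow> bool" where
  "spans_mod I K f \<longleftrightarrow> (\<forall>p. \<exists>c. represents I K f p c)"

definition indep_mod ::
    "('n, 'a::field) mpoly set \<Rightarrow> 'k set \<Rightarrow> ('k \<Rightarrow> ('n, 'a) mpoly) \<Rightarrow> bool" where
  "indep_mod I K f \<longleftrightarrow>
     (\<forall>c. (\<Sum>k\<in>K. pconst (c k) * f k) \<in> I \<longrightarrow> (\<forall>k\<in>K. c k = 0))"

context
  fixes I :: "('n, 'a::field) mpoly set"
  assumes I: "ideal I class_ring"
begin

lemma represents_sum:
  assumes "\<And>j. j \<in> L \<Longrightarrow> represents I K f (g j) (C j)"
  shows "represents I K f (\<Sum>j\<in>L. pconst (a j) * g j) (\<lambda>k. \<Sum>j\<in>L. a j * C j k)"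
proof -
  have "(\<Sum>k\<in>K. pconst (\<Sum>j\<in>L. a j * C j k) * f k) =
      (\<Sum>j\<in>L. pconst (a j) * (\<Sum>k\<in>K. pconst (C j k) * f k))"
    by (simp add: pconst_sum pconst_mult sum_distrib_right sum_distrib_left mult.assoc)
      (rule sum.swap)
  then have "(\<Sum>j\<in>L. pconst (a j) * g j) - (\<Sum>k\<in>K. pconst (\<Sum>j\<in>L. a j * C j k) * f k) =
      (\<Sum>j\<in>L. pconst (a j) * (g j - (\<Sum>k\<in>K. pconst (C j k) * f k)))"
    by (simp add: right_diff_distrib sum_subtractf)
  also have "\<dots> \<in> I"
    using assms by (intro ideal_sum[OF I] ideal_mult[OF I]) (simp add: represents_def)
  finally show ?thesis by (simp add: represents_def)
qed

lemma represents_cong: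
  assumes "p - q \<in> I" "represents I K f q c"
  shows "represents I K f p c"
  using ideal_add[OF I, OF assms(1) assms(2)[unfolded represents_def]]
  by (simp add: represents_def)

lemma represents_trans:
  assumes "represents I L g p a" "\<And>j. j \<in> L \<Longrightarrow> represents I K f (g j) (C j)"
  shows "represents I K f p (\<lambda>k. \<Sum>j\<in>L. a j * C j k)"
  by (rule represents_cong[OF assms(1)[unfolded represents_def] represents_sum[OF assms(2)]])

text \<open>The coordinates stay and the family is multiplied by \<open>x\<close>. Combined with
  \<open>represents_trans\<close> this yields coordinates of \<open>x * p\<close> from a matrix of
  multiplication by \<open>x\<close>.\<close>

lemma represents_mult:
  assumes "represents I L g p a"
  shows "represents I L (\<lambda>j. x * g j) (x * p) a"
  using ideal_mult[OF I, OF assms[unfolded represents_def], of x]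
  by (simp add: represents_def right_diff_distrib sum_distrib_left mult.left_commute)

lemma represents_unique:
  assumes "indep_mod I K f" "represents I K f p c" "represents I K f p d" "k \<in> K"
  shows "c k = d k"
proof -
  have "(\<Sum>k\<in>K. pconst (c k - d k) * f k) =
      (p - (\<Sum>k\<in>K. pconst (d k) * f k)) - (p - (\<Sum>k\<in>K. pconst (c k) * f k))"
    by (simp add: pconst_diff left_diff_distrib sum_subtractf)
  also have "\<dots> \<in> I"
    by (rule ideal_diff[OF I assms(3,2)[unfolded represents_def]])
  finally have "(\<Sum>k\<in>K. pconst (c k - d k) * f k) \<in> I" .
  from assms(1)[unfolded indep_mod_def, THEN spec, THEN mp, OF this] assms(4)
  have "c k - d k = 0" by (rule bspec)
  then show ?thesis by simp
qed

lemma represents_self: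
  assumes "finite K" "k \<in> K"
  shows "represents I K f (f k) (\<lambda>j. if j = k then 1 else 0)"
  using assms by (simp add: represents_def if_distrib[of pconst] if_distrib[of "\<lambda>x. x * _"]
      ideal_0[OF I] cong: if_cong)

lemma indep_mod_imp_distinct:
  assumes "indep_mod I K f" "finite K" "j \<in> K" "k \<in> K" "f j - f k \<in> I"
  shows "j = k"
proof (rule ccontr)
  assume "j \<noteq> k"
  have "represents I K f (f j) (\<lambda>i. if i = k then 1 else 0)"
    by (rule represents_cong[OF assms(5) represents_self[OF assms(2,4), of f]])
  from represents_unique[OF assms(1) represents_self[OF assms(2,3), of f] this assms(3)] \<open>j \<noteq> k\<close>
  show False by simp
qed

text \<open>As long as there is a nontrivial relation, an element with nonzero coefficient is a
  combination of the others and can be discarded.\<close>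

lemma spans_mod_subset_indep:
  assumes "finite K" "spans_mod I K f"
  shows "\<exists>U\<subseteq>K. spans_mod I U f \<and> indep_mod I U f"
  using assms
proof (induction K rule: finite_psubset_induct)
  case (psubset K)
  show ?case
  proof (cases "indep_mod I K f")
    case False
    then obtain c k where c: "(\<Sum>k\<in>K. pconst (c k) * f k) \<in> I" and k: "k \<in> K" "c k \<noteq> 0"
      by (auto simp: indep_mod_def)
    \<comment> \<open>The relation solved for \<open>f k\<close>.\<close>
    define d where "d j = - c j / c k" for j
    have "f k - (\<Sum>j\<in>K - {k}. pconst (d j) * f j) =
        pconst (1 / c k) * (\<Sum>k\<in>K. pconst (c k) * f k)"
      unfolding sum.remove[OF psubset.hyps(1) k(1)]
      using k(2) by (simp add: distrib_left sum_distrib_left flip: mult.assoc pconst_mult)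
        (simp add: d_def pconst_uminus sum_negf)
    then have "represents I (K - {k}) f (f k) d"
      using ideal_mult[OF I c] by (simp add: represents_def)
    moreover have "represents I (K - {k}) f (f j) (\<lambda>i. if i = j then 1 else 0)"
      if "j \<in> K - {k}" for j
      using represents_self[of "K - {k}" j f] psubset.hyps that by simp
    ultimately have "\<exists>C. represents I (K - {k}) f (f j) C" if "j \<in> K" for j
      using that by (cases "j = k") auto
    then obtain C where "represents I (K - {k}) f (f j) (C j)" if "j \<in> K" for j
      by metis
    then have "spans_mod I (K - {k}) f"
      using psubset.prems represents_trans[of K f _ _ "K - {k}" f C]
      unfolding spans_mod_def by blast
    then show ?thesis
      using psubset.IH[of "K - {k}"] k(1) by blast
  qed (use psubset.prems in blast)
qed

section \<open>Cosets and the vector space structure of the quotient\<close>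

abbreviation coset :: "('n, 'a) mpoly \<Rightarrow> ('n, 'a) mpoly set" where
  "coset p \<equiv> I +>\<^bsub>class_ring\<^esub> p"

lemma coset_eq_iff: "coset p = coset q \<longleftrightarrow> p - q \<in> I"
proof
  assume "coset p = coset q"
  moreover have "p \<in> coset p"
    using ideal_0[OF I] by (auto simp: a_r_coset_def')
  ultimately show "p - q \<in> I" by (auto simp: a_r_coset_def')
next
  assume pq: "p - q \<in> I"
  have "x \<in> coset q" if "x \<in> coset p" "p - q \<in> I" for x p q
  proof -
    from that obtain i where "i \<in> I" "x = i + p" by (auto simp: a_r_coset_def')
    with that show ?thesis
      by (auto simp: a_r_coset_def' intro!: bexI[of _ "i + (p - q)"] ideal_add[OF I])
  qed
  from this[of _ p q] this[of _ q p] pq ideal_uminus[OF I pq] show "coset p = coset q"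
    by auto
qed

lemma carrier_quot_alg: "carrier (quot_alg I) = range coset"
  unfolding quot_alg_def ring.defs FactRing_def by (simp add: A_RCOSETS_def' UNION_singleton_eq_range)

lemma zero_quot_alg: "\<zero>\<^bsub>quot_alg I\<^esub> = coset 0"
  by (simp add: quot_alg_def ring.defs FactRing_simps a_r_coset_def')

lemma add_quot_alg: "coset p \<oplus>\<^bsub>quot_alg I\<^esub> coset q = coset (p + q)"
proof -
  interpret ideal I class_ring by (rule I)
  show ?thesis
    using a_rcos_sum[of p q] by (simp add: quot_alg_def ring.defs FactRing_simps)
qed

lemma mult_quot_alg: "coset p \<otimes>\<^bsub>quot_alg I\<^esub> coset q = coset (p * q)"
  using ideal.rcoset_mult_add[OF I, of p q] by (simp add: quot_alg_def ring.defs FactRing_simps)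

lemma smult_quot_alg: "c \<odot>\<^bsub>quot_alg I\<^esub> coset p = coset (pconst c * p)"
  using ideal.rcoset_mult_add[OF I, of "pconst c" p]
  by (simp add: quot_alg_def ring.defs FactRing_simps)

lemma vectorspace_quot_alg: "vectorspace class_ring (quot_alg I)"
proof (intro vectorspace.intro class_field module_criteria ballI)
  show "cring (class_ring :: 'a ring)"
    by (rule class_cring.cring_axioms)
  fix v assume "v \<in> carrier (quot_alg I)"
  then obtain p where "v = coset p" by (auto simp: carrier_quot_alg)
  then show "\<exists>w\<in>carrier (quot_alg I). v \<oplus>\<^bsub>quot_alg I\<^esub> w = \<zero>\<^bsub>quot_alg I\<^esub>"
    by (intro bexI[of _ "coset (- p)"])
      (simp_all add: add_quot_alg zero_quot_alg carrier_quot_alg)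
qed (auto simp: carrier_quot_alg zero_quot_alg add_quot_alg smult_quot_alg pconst_add
    pconst_mult algebra_simps)

interpretation V: vectorspace class_ring "quot_alg I"
  by (rule vectorspace_quot_alg)

lemma finsum_quot_alg:
  "finite K \<Longrightarrow> (\<Oplus>\<^bsub>quot_alg I\<^esub>k\<in>K. coset (f k)) = coset (\<Sum>k\<in>K. f k)"
  by (induction K rule: finite_induct)
    (simp_all add: zero_quot_alg add_quot_alg carrier_quot_alg)

text \<open>Linear combinations in the library run over sets of vectors with coefficients attached
  to the vectors. Injectivity allows passing to a sum over the index set.\<close>

lemma lincomb_quot_alg:
  assumes "finite K" "inj_on (\<lambda>k. coset (f k)) K"
  shows "V.lincomb a ((\<lambda>k. coset (f k)) ` K) = coset (\<Sum>k\<in>K. pconst (a (coset (f k))) * f k)"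
proof -
  have "V.lincomb a ((\<lambda>k. coset (f k)) ` K) =
      (\<Oplus>\<^bsub>quot_alg I\<^esub>k\<in>K. a (coset (f k)) \<odot>\<^bsub>quot_alg I\<^esub> coset (f k))"
    unfolding V.lincomb_def
    by (rule V.add.finprod_reindex) (use assms(2) in \<open>auto simp: smult_quot_alg carrier_quot_alg\<close>)
  then show ?thesis
    by (simp add: smult_quot_alg finsum_quot_alg assms(1))
qed

lemma gen_set_quot_alg:
  assumes "finite K" "inj_on (\<lambda>k. coset (f k)) K"
  shows "V.gen_set ((\<lambda>k. coset (f k)) ` K) \<longleftrightarrow> spans_mod I K f"
proof -
  let ?B = "(\<lambda>k. coset (f k)) ` K"
  have B: "finite ?B" "?B \<subseteq> carrier (quot_alg I)"
    using assms by (auto simp: carrier_quot_alg)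
  have "V.gen_set ?B \<longleftrightarrow> carrier (quot_alg I) \<subseteq> V.span ?B"
    using V.span_is_subset2[OF B(2)] by auto
  also have "\<dots> \<longleftrightarrow> (\<forall>p. \<exists>a. coset p = V.lincomb a ?B)"
    by (auto simp: carrier_quot_alg V.finite_span[OF B] image_subset_iff)
  also have "\<dots> \<longleftrightarrow> (\<forall>p. \<exists>a. represents I K f p (\<lambda>k. a (coset (f k))))"
    by (simp add: lincomb_quot_alg[OF assms] coset_eq_iff represents_def)
  also have "\<dots> \<longleftrightarrow> spans_mod I K f"
  proof -
    have "\<exists>a. represents I K f p (\<lambda>k. a (coset (f k)))" if "represents I K f p c" for p c
    \<comment> \<open>Coefficients attached to indices become coefficients attached to cosets
      through the inverse of the injective indexing.\<close>
    proof (rule exI[of _ "\<lambda>v. c (inv_into K (\<lambda>k. coset (f k)) v)"])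
      have "inv_into K (\<lambda>k. coset (f k)) (coset (f k)) = k" if "k \<in> K" for k
        by (rule inv_into_f_eq[OF assms(2) that refl])
      then show "represents I K f p (\<lambda>k. c (inv_into K (\<lambda>k. coset (f k)) (coset (f k))))"
        using that by (simp add: represents_def cong: sum.cong)
    qed
    moreover have "\<exists>c. represents I K f p c" if "represents I K f p (\<lambda>k. a (coset (f k)))" for p a
      using that by (intro exI[of _ "\<lambda>k. a (coset (f k))"])
    ultimately have "(\<exists>a. represents I K f p (\<lambda>k. a (coset (f k)))) \<longleftrightarrow> (\<exists>c. represents I K f p c)" for p
      by (intro iffI; elim exE)
    then show ?thesis
      unfolding spans_mod_def by (rule iff_allI)
  qed
  finally show ?thesis .
qed

lemma lin_indpt_quot_alg:
  assumes "finite K" "inj_on (\<lambda>k. coset (f k)) K"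
  shows "V.lin_indpt ((\<lambda>k. coset (f k)) ` K) \<longleftrightarrow> indep_mod I K f"
proof -
  let ?B = "(\<lambda>k. coset (f k)) ` K"
  have B: "finite ?B" "?B \<subseteq> carrier (quot_alg I)"
    using assms by (auto simp: carrier_quot_alg)
  have zero: "V.lincomb a ?B = \<zero>\<^bsub>quot_alg I\<^esub> \<longleftrightarrow>
      (\<Sum>k\<in>K. pconst (a (coset (f k))) * f k) \<in> I" for a
    by (simp add: lincomb_quot_alg[OF assms] zero_quot_alg coset_eq_iff)
  show ?thesis
  proof
    assume indpt: "V.lin_indpt ?B"
    show "indep_mod I K f"
      unfolding indep_mod_def
    proof (intro allI impI ballI)
      fix c k assume c: "(\<Sum>k\<in>K. pconst (c k) * f k) \<in> I" and "k \<in> K"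
      define a where "a v = c (inv_into K (\<lambda>k. coset (f k)) v)" for v
      have a: "a (coset (f k)) = c k" if "k \<in> K" for k
        unfolding a_def by (simp add: inv_into_f_eq[OF assms(2) that refl])
      have "V.lincomb a ?B = \<zero>\<^bsub>quot_alg I\<^esub>"
        unfolding zero using c by (simp add: a cong: sum.cong)
      with indpt B(1) \<open>k \<in> K\<close> have "a (coset (f k)) = 0"
        unfolding V.lin_dep_def by auto
      with a \<open>k \<in> K\<close> show "c k = 0" by simp
    qed
  next
    assume "indep_mod I K f"
    then show "V.lin_indpt ?B"
      by (intro V.finite_lin_indpt2 B) (auto simp: zero indep_mod_def)
  qed
qed

lemma basis_quot_alg:
  assumes "finite K" "inj_on (\<lambda>k. coset (f k)) K"
  shows "V.basis ((\<lambda>k. coset (f k)) ` K) \<longleftrightarrow> spans_mod I K f \<and> indep_mod I K f"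
  using gen_set_quot_alg[OF assms] lin_indpt_quot_alg[OF assms]
  by (auto simp: V.basis_def carrier_quot_alg)

lemma inj_on_coset:
  assumes "indep_mod I K f" "finite K"
  shows "inj_on (\<lambda>k. coset (f k)) K"
  using indep_mod_imp_distinct[OF assms] by (intro inj_onI) (simp add: coset_eq_iff)

lemma quot_dim_eq_card:
  assumes "finite K" "spans_mod I K f" "indep_mod I K f"
  shows "quot_dim I = card K"
proof -
  let ?B = "(\<lambda>k. coset (f k)) ` K"
  have inj: "inj_on (\<lambda>k. coset (f k)) K" by (rule inj_on_coset[OF assms(3,1)])
  then have "V.basis ?B" using basis_quot_alg[OF assms(1)] assms by simp
  then show ?thesis
    using V.dim_basis[of ?B] assms(1) card_image[OF inj] by simp
qed

lemma quot_dim_le_card: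
  assumes "finite K" "spans_mod I K f"
  shows "quot_dim I \<le> card K"
proof -
  obtain U where U: "U \<subseteq> K" "spans_mod I U f" "indep_mod I U f"
    using spans_mod_subset_indep[OF assms] by blast
  with quot_dim_eq_card[OF finite_subset[OF U(1) assms(1)] U(2,3)] show ?thesis
    using card_mono[OF assms(1) U(1)] by simp
qed

text \<open>Each basis element is a coset; \<open>f\<close> chooses polynomial
  representatives.\<close>

lemma ordered_basis_coset:
  assumes "ordered_basis I bs"
  obtains f where "bs = map (\<lambda>k. coset (f k)) [0..<length bs]"
    "spans_mod I {..<length bs} f" "indep_mod I {..<length bs} f"
proof -
  have basis: "distinct bs" "V.basis (set bs)"
    using assms by (auto simp: ordered_basis_def)
  then have "set bs \<subseteq> range coset"
    by (simp add: V.basis_def carrier_quot_alg)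
  then have "\<exists>p. bs ! k = coset p" if "k < length bs" for k
    using subsetD[OF \<open>set bs \<subseteq> range coset\<close> nth_mem[OF that]] by (simp add: image_iff)
  then obtain f where f: "bs ! k = coset (f k)" if "k < length bs" for k
    by metis
  have bs: "bs = map (\<lambda>k. coset (f k)) [0..<length bs]"
    by (rule nth_equalityI) (auto simp: f)
  have "inj_on (\<lambda>k. coset (f k)) {..<length bs}"
  proof (rule inj_onI)
    fix i j assume ij: "i \<in> {..<length bs}" "j \<in> {..<length bs}" "coset (f i) = coset (f j)"
    then have "bs ! i = bs ! j" by (simp add: f)
    with ij show "i = j" using nth_eq_iff_index_eq[OF basis(1)] by simp
  qed
  moreover have "(\<lambda>k. coset (f k)) ` {..<length bs} = set bs"
    using arg_cong[OF bs, of set] unfolding set_map set_upt atLeast0LessThan by (rule sym)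
  ultimately have "spans_mod I {..<length bs} f \<and> indep_mod I {..<length bs} f"
    using basis(2) basis_quot_alg[of "{..<length bs}" f] by simp
  with that[OF bs] show ?thesis by blast
qed

lemma ordered_basis_map_coset:
  assumes "spans_mod I {..<N} f" "indep_mod I {..<N} f"
  shows "ordered_basis I (map (\<lambda>k. coset (f k)) [0..<N])"
  using inj_on_coset[OF assms(2)] basis_quot_alg[of "{..<N}" f] assms
  by (simp add: ordered_basis_def distinct_map atLeast0LessThan)

lemma length_ordered_basis:
  assumes "ordered_basis I bs"
  shows "length bs = quot_dim I"
  using V.dim_basis[of "set bs"] assms by (simp add: ordered_basis_def distinct_card)

lemma ordered_basis_exists:
  assumes "quot_fin_dim I"
  shows "\<exists>bs. ordered_basis I bs"
  using V.finite_basis_exists[OF assms] finite_distinct_list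
  by (auto simp: ordered_basis_def)

text \<open>This justifies the definite description in \<open>mult_mat\<close>: a matrix with the
  required columns exists because the family spans, and is unique because the family is
  independent.\<close>

lemma represents_mult_mat:
  assumes "spans_mod I {..<N} f" "indep_mod I {..<N} f" "j < N"
  shows "represents I {..<N} f (g * f j)
    (\<lambda>k. mult_mat I (map (\<lambda>k. coset (f k)) [0..<N]) g $$ (k, j))"
proof -
  let ?bs = "map (\<lambda>k. coset (f k)) [0..<N]"
  have eq: "(coset g \<otimes>\<^bsub>quot_alg I\<^esub> ?bs ! j =
        (\<Oplus>\<^bsub>quot_alg I\<^esub>k\<in>{..<N}. A $$ (k, j) \<odot>\<^bsub>quot_alg I\<^esub> ?bs ! k)) \<longleftrightarrow>
      represents I {..<N} f (g * f j) (\<lambda>k. A $$ (k, j))" if "j < N" for A j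
  proof -
    have "(\<Oplus>\<^bsub>quot_alg I\<^esub>k\<in>{..<N}. A $$ (k, j) \<odot>\<^bsub>quot_alg I\<^esub> ?bs ! k) =
        (\<Oplus>\<^bsub>quot_alg I\<^esub>k\<in>{..<N}. coset (pconst (A $$ (k, j)) * f k))"
      by (rule V.add.finprod_cong') (auto simp: smult_quot_alg carrier_quot_alg)
    then show ?thesis
      using that by (simp add: mult_quot_alg finsum_quot_alg coset_eq_iff represents_def)
  qed
  have "\<forall>j. \<exists>c. represents I {..<N} f (g * f j) c"
    using assms(1) unfolding spans_mod_def by blast
  then obtain C where C: "represents I {..<N} f (g * f j) (C j)" for j
    by metis
  let ?P = "\<lambda>A. A \<in> carrier_mat N N \<and>
      (\<forall>j<N. represents I {..<N} f (g * f j) (\<lambda>k. A $$ (k, j)))"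
  have "\<exists>!A. ?P A"
  proof
    have "represents I {..<N} f (g * f j) (\<lambda>k. mat N N (\<lambda>(k, j). C j k) $$ (k, j))"
      if "j < N" for j
      using C[of j] that by (simp add: represents_def)
    then show "?P (mat N N (\<lambda>(k, j). C j k))" by simp
    show "A = mat N N (\<lambda>(k, j). C j k)" if A: "?P A" for A
    proof (rule eq_matI)
      fix k j assume "k < dim_row (mat N N (\<lambda>(k, j). C j k))" "j < dim_col (mat N N (\<lambda>(k, j). C j k))"
      then have kj: "k < N" "j < N" by simp_all
      with A have "represents I {..<N} f (g * f j) (\<lambda>k. A $$ (k, j))" by blast
      from represents_unique[OF assms(2) this C, of k] kj
      show "A $$ (k, j) = mat N N (\<lambda>(k, j). C j k) $$ (k, j)" by simp
    qed (use A in auto)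
  qed
  moreover have "mult_mat I ?bs g = (THE A. ?P A)"
    unfolding mult_mat_def length_map length_upt diff_zero
    by (intro arg_cong[of _ _ The] ext conj_cong refl all_cong eq)
  ultimately have "?P (mult_mat I ?bs g)"
    using theI'[of ?P] by simp
  then show ?thesis using assms(3) by simp
qed

end

section \<open>Multiplication matrices and hyperplanes\<close>

text \<open>The matrix of \<open>general_mult_mat\<close> for arbitrary coefficients:
  \<open>M i\<close> is meant to be a matrix of multiplication by the variable \<open>i\<close>,
  known through \<open>represents\<close> instead of a chosen basis.\<close>

definition pencil :: "nat \<Rightarrow> ('n::finite \<Rightarrow> nat \<Rightarrow> nat \<Rightarrow> 'a::comm_ring_1) \<Rightarrow> ('n, 'a) mpoly mat" where
  "pencil N M = mat N N (\<lambda>(k, j). \<Sum>i\<in>UNIV. pvar i * pconst (M i k j))"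

text \<open>The hypotheses give \<open>M = Q M' P\<close> for the constant matrices of the change of basis.\<close>

lemma Idl_minors_pencil_subset:
  fixes I :: "('n::finite, 'a::field) mpoly set"
  assumes I: "ideal I class_ring"
    and f: "spans_mod I {..<N} f" "indep_mod I {..<N} f"
    and g: "spans_mod I {..<N'} g"
    and M: "\<And>i j. j < N \<Longrightarrow> represents I {..<N} f (pvar i * f j) (\<lambda>k. M i k j)"
    and M': "\<And>i j. j < N' \<Longrightarrow> represents I {..<N'} g (pvar i * g j) (\<lambda>k. M' i k j)"
  shows "Idl\<^bsub>class_ring\<^esub> (minors r (pencil N M)) \<subseteq> Idl\<^bsub>class_ring\<^esub> (minors r (pencil N' M'))"
proof -
  have "\<forall>j. \<exists>c. represents I {..<N'} g (f j) c"
    using g unfolding spans_mod_def by blast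
  then obtain P where P: "represents I {..<N'} g (f j) (P j)" for j
    by metis
  have "\<forall>j. \<exists>c. represents I {..<N} f (g j) c"
    using f unfolding spans_mod_def by blast
  then obtain Q where Q: "represents I {..<N} f (g j) (Q j)" for j
    by metis
  \<comment> \<open>Rewriting \<open>f j\<close> in terms of \<open>g\<close>, multiplying by the
    variable there and returning to \<open>f\<close> gives a second coordinate vector of
    \<open>pvar i * f j\<close>. Independence of \<open>f\<close> identifies it with column
    \<open>j\<close> of \<open>M i\<close>.\<close>
  have M_eq: "M i c j = (\<Sum>b<N'. (\<Sum>a<N'. P j a * M' i b a) * Q b c)" if "j < N" "c < N" for i c j
  proof -
    have "represents I {..<N'} g (pvar i * f j) (\<lambda>b. \<Sum>a<N'. P j a * M' i b a)"
      by (rule represents_trans[OF I represents_mult[OF I P[of j], of "pvar i"]]) (use M' in auto)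
    from represents_trans[OF I this, of "{..<N}" f Q] Q
    have "represents I {..<N} f (pvar i * f j) (\<lambda>c. \<Sum>b<N'. (\<Sum>a<N'. P j a * M' i b a) * Q b c)"
      by blast
    from represents_unique[OF I f(2) M[OF that(1)] this, of c] that(2) show ?thesis
      unfolding lessThan_iff by blast
  qed
  \<comment> \<open>The two transition matrices, with field elements read as constant
    polynomials.\<close>
  define X where "X = mat N N' (\<lambda>(c, b). pconst (Q b c) :: ('n, 'a) mpoly)"
  define Y where "Y = mat N' N (\<lambda>(a, j). pconst (P j a) :: ('n, 'a) mpoly)"
  have carrier: "X \<in> carrier_mat N N'" "Y \<in> carrier_mat N' N" "pencil N' M' \<in> carrier_mat N' N'"
    by (simp_all add: X_def Y_def pencil_def)
  have "pencil N M = X * (pencil N' M' * Y)"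
  proof (rule eq_matI)
    fix c j assume "c < dim_row (X * (pencil N' M' * Y))" "j < dim_col (X * (pencil N' M' * Y))"
    then have cj: "c < N" "j < N" using carrier by auto
    have "(X * (pencil N' M' * Y)) $$ (c, j) =
        (\<Sum>b<N'. \<Sum>a<N'. \<Sum>i\<in>UNIV. pconst (Q b c) * (pvar i * pconst (M' i b a) * pconst (P j a)))"
      using cj by (simp add: X_def Y_def pencil_def scalar_prod_def atLeast0LessThan
          sum_distrib_left sum_distrib_right)
    also have "\<dots> = (\<Sum>b<N'. \<Sum>i\<in>UNIV. \<Sum>a<N'.
        pconst (Q b c) * (pvar i * pconst (M' i b a) * pconst (P j a)))"
      by (intro sum.cong refl sum.swap)
    also have "\<dots> = (\<Sum>i\<in>UNIV. \<Sum>b<N'. \<Sum>a<N'.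
        pconst (Q b c) * (pvar i * pconst (M' i b a) * pconst (P j a)))"
      by (rule sum.swap)
    also have "\<dots> = (\<Sum>i\<in>UNIV. pvar i * pconst (M i c j))"
      unfolding M_eq[OF cj(2,1)]
      by (simp add: pconst_sum pconst_mult sum_distrib_left sum_distrib_right mult.commute
          mult.left_commute)
    finally show "pencil N M $$ (c, j) = (X * (pencil N' M' * Y)) $$ (c, j)"
      using cj by (simp add: pencil_def)
  qed (use carrier in \<open>simp_all add: pencil_def\<close>)
  then have "Idl\<^bsub>class_ring\<^esub> (minors r (pencil N M)) \<subseteq>
      Idl\<^bsub>class_ring\<^esub> (minors r (pencil N' M' * Y))"
    using Idl_minors_mult_left[OF carrier(1) mult_carrier_mat[OF carrier(3,2)]] by simp
  also have "\<dots> \<subseteq> Idl\<^bsub>class_ring\<^esub> (minors r (pencil N' M'))"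
    by (rule Idl_minors_mult_right[OF carrier(3,2)])
  finally show ?thesis .
qed

lemma general_mult_mat_eq_pencil:
  "general_mult_mat I bs = pencil (length bs) (\<lambda>i k j. mult_mat I bs (pvar i) $$ (k, j))"
  by (simp add: general_mult_mat_def pencil_def)

text \<open>Basis independence: the arbitrary basis in the definition of \<open>rich_ideal\<close>
  may be replaced by any \<open>f\<close>. Both inclusions are instances of
  \<open>Idl_minors_pencil_subset\<close>.\<close>

lemma rich_ideal_eq_Idl_pencil:
  fixes I :: "('n::finite, 'a::field) mpoly set"
  assumes I: "ideal I class_ring"
    and f: "spans_mod I {..<N} f" "indep_mod I {..<N} f"
    and M: "\<And>i j. j < N \<Longrightarrow> represents I {..<N} f (pvar i * f j) (\<lambda>k. M i k j)"
  shows "rich_ideal I m = Idl\<^bsub>class_ring\<^esub> (minors (N + 1 - m) (pencil N M))"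
proof -
  define bs where "bs = (SOME bs. ordered_basis I bs)"
  have N: "quot_dim I = N"
    using quot_dim_eq_card[OF I _ f] by simp
  \<comment> \<open>The classes of the \<open>f k\<close> show that an ordered basis exists, so the
    choice operator returns one.\<close>
  have "ordered_basis I bs"
    unfolding bs_def using ordered_basis_map_coset[OF I f] by (rule someI)
  moreover from this have len: "length bs = N"
    using length_ordered_basis[OF I] N by simp
  ultimately obtain g where bs: "bs = map (\<lambda>k. I +>\<^bsub>class_ring\<^esub> g k) [0..<N]"
    and g: "spans_mod I {..<N} g" "indep_mod I {..<N} g"
    using ordered_basis_coset[OF I, of bs] by metis
  have M': "represents I {..<N} g (pvar i * g j) (\<lambda>k. mult_mat I bs (pvar i) $$ (k, j))"
    if "j < N" for i j
    unfolding bs by (rule represents_mult_mat[OF I g that])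
  have "rich_ideal I m = Idl\<^bsub>class_ring\<^esub> (minors (N + 1 - m)
      (pencil N (\<lambda>i k j. mult_mat I bs (pvar i) $$ (k, j))))"
    by (simp add: rich_ideal_def general_mult_mat_eq_pencil N len flip: bs_def)
  also have "\<dots> = Idl\<^bsub>class_ring\<^esub> (minors (N + 1 - m) (pencil N M))"
    by (intro equalityI Idl_minors_pencil_subset[OF I g f(1)] Idl_minors_pencil_subset[OF I f g(1)]
        M M')
  finally show ?thesis .
qed

section \<open>The quotient by a further element and the rank of multiplication\<close>

lemma Idl_singleton: "Idl\<^bsub>class_ring\<^esub> {l} = range (\<lambda>q. q * (l :: 'r::comm_ring_1))"
proof
  have "ideal (range (\<lambda>q. q * l)) class_ring"
    unfolding ideal_class_ring_iff
    by (auto simp: image_iff simp flip: distrib_right mult.assoc intro: exI[of _ 0])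
  then show "Idl\<^bsub>class_ring\<^esub> {l} \<subseteq> range (\<lambda>q. q * l)"
    by (rule Idl_least) (auto simp: image_iff intro: exI[of _ 1])
  show "range (\<lambda>q. q * l) \<subseteq> Idl\<^bsub>class_ring\<^esub> {l}"
    using Idl_superset[of "{l}"] by (auto intro: ideal_mult[OF ideal_Idl])
qed

lemma mem_ideal_add_Idl_singleton:
  "x \<in> I <+>\<^bsub>class_ring\<^esub> (Idl\<^bsub>class_ring\<^esub> {l}) \<longleftrightarrow> (\<exists>q. x - q * (l :: 'r::comm_ring_1) \<in> I)"
proof
  assume "x \<in> I <+>\<^bsub>class_ring\<^esub> (Idl\<^bsub>class_ring\<^esub> {l})"
  then obtain i q where "i \<in> I" "x = i + q * l"
    by (auto simp: Idl_singleton set_add_def')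
  then show "\<exists>q. x - q * l \<in> I"
    by (intro exI[of _ q]) simp
next
  assume "\<exists>q. x - q * l \<in> I"
  then obtain q where "x - q * l \<in> I" ..
  then show "x \<in> I <+>\<^bsub>class_ring\<^esub> (Idl\<^bsub>class_ring\<^esub> {l})"
    by (auto simp: Idl_singleton set_add_def' intro!: bexI[of _ "x - q * l"] exI[of _ q])
qed

text \<open>Multiplication by \<open>l\<close> on \<open>R\<close> has image \<open>J / I\<close>
  for the sum \<open>J\<close> of \<open>I\<close> and the ideal of \<open>l\<close>, so the
  quotient by \<open>J\<close> has dimension \<open>N\<close> minus the rank of \<open>A\<close>.
  The form \<open>N < k + ...\<close> avoids truncated subtraction and remains correct for
  \<open>k > N\<close>, where there are no minors.\<close>

lemma minors_vanish_iff_quot_dim: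
  fixes I :: "('n, 'a::field) mpoly set"
  assumes I: "ideal I class_ring"
    and f: "spans_mod I {..<N} f" "indep_mod I {..<N} f"
    and A: "A \<in> carrier_mat N N"
    and rep: "\<And>j. j < N \<Longrightarrow> represents I {..<N} f (l * f j) (\<lambda>k. A $$ (k, j))"
  shows "(\<forall>x\<in>minors k A. x = 0) \<longleftrightarrow>
    N < k + quot_dim (I <+>\<^bsub>class_ring\<^esub> (Idl\<^bsub>class_ring\<^esub> {l}))"
proof -
  define J where "J = I <+>\<^bsub>class_ring\<^esub> (Idl\<^bsub>class_ring\<^esub> {l})"
  have J_iff: "x \<in> J \<longleftrightarrow> (\<exists>q. x - q * l \<in> I)" for x
    unfolding J_def by (rule mem_ideal_add_Idl_singleton)
  have J: "ideal J class_ring"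
    unfolding J_def by (intro ring.add_ideals[OF class_ring.ring_axioms] I ideal_Idl)
  have IJ: "x \<in> J" if "x \<in> I" for x
    using that by (auto simp: J_iff intro!: exI[of _ 0])
  have lJ: "q * l \<in> J" for q
    by (auto simp: J_iff ideal_0[OF I] intro!: exI[of _ q])
  have spans_J: "spans_mod J {..<N} f"
    using f(1) IJ unfolding spans_mod_def represents_def by blast
  have "k + quot_dim J \<le> N" if x: "x \<in> minors k A" "x \<noteq> 0" for x
  proof -
    obtain S T where ST: "S \<subseteq> {..<N}" "T \<subseteq> {..<N}" "card S = k" "card T = k"
      and x_eq: "x = minor k A (pick S) (pick T)"
      using x(1) A by (auto simp: minors_eq)
    have fin: "finite S" using ST(1) finite_subset by blast
    define B where "B = mat k k (\<lambda>(i, j). A $$ (pick S i, pick T j))"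
    \<comment> \<open>The inverse of the block \<open>B\<close>, through the adjugate;
      \<open>det B\<close> is the given nonzero minor \<open>x\<close>.\<close>
    define Y where "Y = (1 / det B) \<cdot>\<^sub>m adj_mat B"
    have B: "B \<in> carrier_mat k k" by (simp add: B_def)
    have "det B \<noteq> 0" using x(2) by (simp add: x_eq minor_def B_def)
    have "B * Y = (1 / det B) \<cdot>\<^sub>m (B * adj_mat B)"
      unfolding Y_def by (rule mult_smult_distrib[OF B adj_mat(1)[OF B]])
    then have BY: "B * Y = 1\<^sub>m k"
      using adj_mat(2)[OF B] \<open>det B \<noteq> 0\<close> by (auto intro!: eq_matI)
    have Y: "Y \<in> carrier_mat k k" using adj_mat(1)[OF B] by (simp add: Y_def)
    have sum_BY: "(\<Sum>j<k. Y $$ (j, i') * A $$ (pick S i, pick T j)) = (if i = i' then 1 else 0)"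
      if "i < k" "i' < k" for i i'
      using arg_cong[OF BY, of "\<lambda>M. M $$ (i, i')"] that B Y
      by (simp add: scalar_prod_def atLeast0LessThan B_def mult.commute)
    have "\<exists>c. represents J ({..<N} - S) f (f s) c" if "s \<in> S" for s
    proof -
      obtain i' where i': "i' < k" "pick S i' = s"
        using pick_surj[OF fin \<open>s \<in> S\<close>] ST(3) by blast
      \<comment> \<open>Column \<open>i'\<close> of \<open>Y\<close> combines the products
        \<open>l * f (pick T j)\<close> into \<open>?L\<close>, an element of \<open>J\<close> whose
        coordinates modulo \<open>I\<close> are \<open>e\<close>.\<close>
      define e where "e a = (\<Sum>j<k. Y $$ (j, i') * A $$ (a, pick T j))" for a
      let ?L = "\<Sum>j<k. pconst (Y $$ (j, i')) * (l * f (pick T j))"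
      have "represents I {..<N} f ?L e"
        unfolding e_def by (rule represents_sum[OF I]) (use ST pick_less in \<open>auto intro!: rep\<close>)
      then have "?L - (\<Sum>a<N. pconst (e a) * f a) \<in> J"
        by (auto simp: represents_def intro: IJ)
      moreover have "?L \<in> J"
        by (rule ideal_sum[OF J], rule ideal_mult[OF J])
          (subst mult.commute, rule lJ)
      ultimately have "(\<Sum>a<N. pconst (e a) * f a) \<in> J"
        using ideal_diff[OF J, of ?L "?L - (\<Sum>a<N. pconst (e a) * f a)"] by simp
      \<comment> \<open>On the rows in \<open>S\<close> these coordinates form the unit vector at
        \<open>s\<close>, because \<open>Y\<close> is a right inverse of \<open>B\<close>. The
        relation thus isolates \<open>f s\<close> and otherwise involves only indices outside
        \<open>S\<close>.\<close>
      moreover have "e a = (if a = s then 1 else 0)" if "a \<in> S" for a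
      proof -
        obtain i where i: "i < k" "pick S i = a"
          using pick_surj[OF fin \<open>a \<in> S\<close>] ST(3) by blast
        have "i = i' \<longleftrightarrow> a = s"
          using i i' pick_eq_iff[OF fin, of i i'] ST(3) by simp
        then show ?thesis
          using sum_BY[OF i(1) i'(1)] by (simp add: e_def i)
      qed
      then have "(\<Sum>a\<in>S. pconst (e a) * f a) = (\<Sum>a\<in>S. if a = s then f a else 0)"
        by (intro sum.cong) auto
      then have "(\<Sum>a\<in>S. pconst (e a) * f a) = f s"
        using fin \<open>s \<in> S\<close> by simp
      ultimately have "f s + (\<Sum>a\<in>{..<N} - S. pconst (e a) * f a) \<in> J"
        using sum.subset_diff[OF ST(1), of "\<lambda>a. pconst (e a) * f a"] by (simp add: add.commute)
      then have "represents J ({..<N} - S) f (f s) (\<lambda>a. - e a)"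
        by (simp add: represents_def pconst_uminus sum_negf)
      then show ?thesis by blast
    qed
    moreover have "\<exists>c. represents J ({..<N} - S) f (f s) c" if "s \<in> {..<N} - S" for s
      using represents_self[OF J, of "{..<N} - S" s f] that by auto
    ultimately have "\<forall>s\<in>{..<N}. \<exists>c. represents J ({..<N} - S) f (f s) c"
      by blast
    from bchoice[OF this] obtain C
      where C: "\<forall>s\<in>{..<N}. represents J ({..<N} - S) f (f s) (C s)" ..
    have "spans_mod J ({..<N} - S) f"
      unfolding spans_mod_def
    proof
      fix p
      from spans_J obtain c where "represents J {..<N} f p c"
        unfolding spans_mod_def by blast
      then have "represents J ({..<N} - S) f p (\<lambda>k. \<Sum>j<N. c j * C j k)"
        by (rule represents_trans[OF J]) (rule bspec[OF C])
      then show "\<exists>c. represents J ({..<N} - S) f p c" by blast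
    qed
    then have "quot_dim J \<le> card ({..<N} - S)"
      by (intro quot_dim_le_card[OF J]) auto
    then show ?thesis
      using ST(1,3) fin card_mono[OF _ ST(1)] by (simp add: card_Diff_subset)
  qed
  \<comment> \<open>For the converse, \<open>k\<close> rows avoiding a basis modulo \<open>J\<close>
    are shown to have a right inverse.\<close>
  moreover have "\<not> (\<forall>x\<in>minors k A. x = 0)" if le: "k + quot_dim J \<le> N"
  proof
    assume zero: "\<forall>x\<in>minors k A. x = 0"
    obtain U where U: "U \<subseteq> {..<N}" "spans_mod J U f" "indep_mod J U f"
      using spans_mod_subset_indep[OF J _ spans_J] by auto
    have fin: "finite U" using U(1) finite_subset by blast
    have "card ({..<N} - U) = N - quot_dim J"
      using quot_dim_eq_card[OF J fin U(2,3)] U(1) fin by (simp add: card_Diff_subset)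
    with le have "k \<le> card ({..<N} - U)" by simp
    then obtain S where S: "S \<subseteq> {..<N} - U" "card S = k" "finite S"
      by (rule obtain_subset_with_card_n)
    \<comment> \<open>Column \<open>s\<close> of the right inverse: modulo \<open>I\<close>,
      \<open>f s\<close> is a combination of the \<open>f u\<close> with \<open>u\<close> in
      \<open>U\<close> plus a multiple \<open>q * l\<close>, and \<open>x\<close> is the coordinate
      vector of \<open>q\<close>.\<close>
    have "\<exists>x. \<forall>a\<in>S. (\<Sum>j<N. A $$ (a, j) * x j) = (if a = s then 1 else 0)" if "s \<in> S" for s
    proof -
      from U(2) obtain c where "represents J U f (f s) c"
        unfolding spans_mod_def by blast
      then obtain q where q: "f s - (\<Sum>u\<in>U. pconst (c u) * f u) - q * l \<in> I"
        by (auto simp: represents_def J_iff)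
      from f(1) obtain x where x: "represents I {..<N} f q x"
        unfolding spans_mod_def by blast
      define e where "e a = (\<Sum>j<N. x j * A $$ (a, j))" for a
      have "represents I {..<N} f (l * q) e"
        unfolding e_def by (rule represents_trans[OF I represents_mult[OF I x, of l]])
          (use rep in auto)
      then have lq: "q * l - (\<Sum>a<N. pconst (e a) * f a) \<in> I"
        by (simp add: represents_def mult.commute)
      \<comment> \<open>The coefficients \<open>c\<close> padded by zeros. They vanish on
        \<open>S\<close>, which is disjoint from \<open>U\<close>, so on \<open>S\<close> the
        coordinates of \<open>f s\<close> are those of \<open>q * l\<close>.\<close>
      define d where "d a = (if a \<in> U then c a else 0)" for a
      have "(\<Sum>a<N. pconst (d a) * f a) = (\<Sum>u\<in>U. pconst (c u) * f u)"
        using U(1) by (intro sum.mono_neutral_cong_right) (auto simp: d_def)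
      then have "f s - (\<Sum>a<N. pconst (d a + e a) * f a) =
          (f s - (\<Sum>u\<in>U. pconst (c u) * f u) - q * l) + (q * l - (\<Sum>a<N. pconst (e a) * f a))"
        by (simp add: pconst_add distrib_right sum.distrib)
      then have de: "represents I {..<N} f (f s) (\<lambda>a. d a + e a)"
        unfolding represents_def using ideal_add[OF I q lq] by (rule ssubst)
      have self: "represents I {..<N} f (f s) (\<lambda>a. if a = s then 1 else 0)"
        using represents_self[OF I, of "{..<N}" s f] S(1) \<open>s \<in> S\<close> by auto
      have eq: "d a + e a = (if a = s then 1 else 0)" if "a < N" for a
        using represents_unique[OF I f(2) de self, of a] that by simp
      have "e a = (if a = s then 1 else 0)" if "a \<in> S" for a
        using eq[of a] that S(1) by (auto simp: d_def)
      then show ?thesis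
        by (intro exI[of _ x]) (simp add: e_def mult.commute)
    qed
    then have "\<forall>s\<in>S. \<exists>x. \<forall>a\<in>S. (\<Sum>j<N. A $$ (a, j) * x j) = (if a = s then 1 else 0)"
      by (rule ballI)
    from bchoice[OF this] obtain X where
      "\<forall>s\<in>S. \<forall>a\<in>S. (\<Sum>j<N. A $$ (a, j) * X s j) = (if a = s then 1 else 0)" ..
    then have X: "(\<Sum>j<N. A $$ (a, j) * X s j) = (if a = s then 1 else 0)"
      if "s \<in> S" "a \<in> S" for a s
      using that by (blast dest: bspec)
    \<comment> \<open>The rows of \<open>A\<close> in \<open>S\<close> times their right inverse. By
      multilinear expansion the determinant 1 lies in the ideal of the \<open>k\<close>-minors,
      which is zero by assumption.\<close>
    have "mat k k (\<lambda>(i, j). \<Sum>h<dim_col A. A $$ (pick S i, h) * X (pick S j) h) = 1\<^sub>m k"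
    proof (rule eq_matI)
      fix i j assume "i < dim_row (1\<^sub>m k :: 'a mat)" "j < dim_col (1\<^sub>m k :: 'a mat)"
      then have ij: "i < k" "j < k" by simp_all
      then have "pick S i = pick S j \<longleftrightarrow> i = j"
        using pick_eq_iff[OF S(3)] S(2) by simp
      with ij show "mat k k (\<lambda>(i, j). \<Sum>h<dim_col A. A $$ (pick S i, h) * X (pick S j) h) $$ (i, j) =
          1\<^sub>m k $$ (i, j)"
        using A X[of "pick S j" "pick S i"] pick_in_set_le[of _ S] S(2) by simp
    qed auto
    then have "1 \<in> Idl\<^bsub>class_ring\<^esub> (minors k A)"
      using det_mult_cols_mem_Idl_minors[of k "pick S" A "\<lambda>h j. X (pick S j) h"] A S
        pick_less[of S N] by auto
    moreover have "Idl\<^bsub>class_ring\<^esub> (minors k A) \<subseteq> {0}"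
      by (rule Idl_least) (use zero in \<open>auto simp: ideal_class_ring_iff\<close>)
    ultimately show False by auto
  qed
  ultimately show ?thesis
    unfolding J_def[symmetric] by (meson not_le)
qed

section \<open>Extension of scalars\<close>

lemma map_mem_extend_ideal: "p \<in> I \<Longrightarrow> Poly_Mapping.map \<phi> p \<in> extend_ideal \<phi> I"
  unfolding extend_ideal_def using Idl_superset by blast

lemma represents_extend_ideal:
  assumes "field_hom \<phi>" "represents I K f p c"
  shows "represents (extend_ideal \<phi> I) K (\<lambda>k. Poly_Mapping.map \<phi> (f k)) (Poly_Mapping.map \<phi> p)
    (\<lambda>k. \<phi> (c k))"
proof -
  interpret field_hom \<phi> by fact
  interpret m: comm_ring_hom "Poly_Mapping.map \<phi> :: ('c, 'a) mpoly \<Rightarrow> ('c, 'b) mpoly"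
    by (rule comm_ring_hom_map) unfold_locales
  show ?thesis
    using map_mem_extend_ideal[OF assms(2)[unfolded represents_def], of \<phi>]
    by (simp add: represents_def m.hom_minus m.hom_sum m.hom_mult map_pconst)
qed

text \<open>Monomials are already defined over the small field, so their coordinates there can be
  mapped by \<phi>; every other polynomial is an \<open>E\<close>-linear combination of
  monomials.\<close>

lemma spans_mod_extend_ideal:
  fixes \<phi> :: "'a::field \<Rightarrow> 'e::field" and I :: "('n, 'a) mpoly set"
  assumes \<phi>: "field_hom \<phi>" and f: "spans_mod I K f"
  shows "spans_mod (extend_ideal \<phi> I) K (\<lambda>k. Poly_Mapping.map \<phi> (f k))"
  unfolding spans_mod_def
proof
  interpret field_hom \<phi> by fact
  have E: "ideal (extend_ideal \<phi> I) class_ring"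
    unfolding extend_ideal_def by (rule ideal_Idl)
  fix p :: "('n, 'e) mpoly"
  have "\<forall>e. \<exists>c. represents I K f (Poly_Mapping.single e 1) c"
    using f unfolding spans_mod_def by blast
  then obtain C where "represents I K f (Poly_Mapping.single e 1) (C e)" for e
    by metis
  from represents_extend_ideal[OF \<phi> this]
  have C: "represents (extend_ideal \<phi> I) K (\<lambda>k. Poly_Mapping.map \<phi> (f k))
      (Poly_Mapping.single e 1) (\<lambda>k. \<phi> (C e k))" for e
    by simp
  show "\<exists>c. represents (extend_ideal \<phi> I) K (\<lambda>k. Poly_Mapping.map \<phi> (f k)) p c"
    by (subst mpoly_sum_monomials) (rule exI, rule represents_sum[OF E C])
qed

text \<open>The coordinate functionals of \<open>R\<close> extend to \<open>E\<close>-linear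
  functionals that vanish on the extended ideal and remain dual to the images of the
  \<open>f k\<close>. Applying them to a relation returns its coefficients.\<close>

lemma indep_mod_extend_ideal:
  fixes \<phi> :: "'a::field \<Rightarrow> 'e::field" and I :: "('n, 'a) mpoly set"
  assumes \<phi>: "field_hom \<phi>" and I: "ideal I class_ring" and K: "finite K"
    and f: "spans_mod I K f" "indep_mod I K f"
  shows "indep_mod (extend_ideal \<phi> I) K (\<lambda>k. Poly_Mapping.map \<phi> (f k))"
proof -
  interpret field_hom \<phi> by fact
  interpret m: comm_ring_hom "Poly_Mapping.map \<phi> :: ('n, 'a) mpoly \<Rightarrow> ('n, 'e) mpoly"
    by (rule comm_ring_hom_map) unfold_locales
  have "\<forall>e. \<exists>c. represents I K f (Poly_Mapping.single e 1) c"
    using f(1) unfolding spans_mod_def by blast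
  then obtain C where C: "represents I K f (Poly_Mapping.single e 1) (C e)" for e
    by metis
  \<comment> \<open>the \<open>E\<close>-linear extension of the \<open>k\<close>-th coordinate functional of \<open>R\<close>\<close>
  define T where "T k = lin_ext (\<lambda>e. \<phi> (C e k))" for k
  have T_map: "T k (Poly_Mapping.map \<phi> p) = \<phi> (c k)" if "represents I K f p c" "k \<in> K" for p c k
  proof -
    have "represents I K f p (\<lambda>k. \<Sum>e\<in>Poly_Mapping.keys p. Poly_Mapping.lookup p e * C e k)"
      by (subst (1) mpoly_sum_monomials[of p]) (rule represents_sum[OF I C])
    from represents_unique[OF I f(2) that(1) this that(2)]
    have "\<phi> (c k) = (\<Sum>e\<in>Poly_Mapping.keys p. \<phi> (Poly_Mapping.lookup p e) * \<phi> (C e k))"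
      by (simp add: hom_sum hom_mult)
    then show ?thesis
      unfolding T_def
      by (simp add: lin_ext_superset[OF finite_keys keys_map_subset] lookup_map_hom)
  qed
  \<comment> \<open>By linearity \<open>q\<close> may be taken to be a monomial times a constant.
    The monomial times \<open>p\<close> stays in \<open>I\<close>, so its coordinates are
    zero.\<close>
  have T_I: "T k (q * Poly_Mapping.map \<phi> p) = 0" if "p \<in> I" "k \<in> K" for p q k
  proof (induction q rule: mpoly_induct)
    case (monomial e c)
    have "represents I K f (Poly_Mapping.single e 1 * p) (\<lambda>_. 0)"
      using ideal_mult[OF I \<open>p \<in> I\<close>] by (simp add: represents_def)
    from T_map[OF this \<open>k \<in> K\<close>]
    have "T k (Poly_Mapping.map \<phi> (Poly_Mapping.single e 1 * p)) = 0" by simp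
    then have "T k (pconst c * (Poly_Mapping.single e 1 * Poly_Mapping.map \<phi> p)) = 0"
      unfolding T_def lin_ext_pconst_mult m.hom_mult by simp
    then show ?case by (simp add: pconst_mult_single flip: mult.assoc)
  qed (simp_all add: T_def lin_ext_add distrib_right)
  have T_E: "T k p = 0" if "p \<in> extend_ideal \<phi> I" "k \<in> K" for p k
  proof -
    \<comment> \<open>The functional \<open>T k\<close> is only linear, so its kernel need not be an
      ideal. \<open>?Z\<close> is the largest ideal inside the kernel, and it contains the
      generators of the extended ideal.\<close>
    let ?Z = "{p. \<forall>q. T k (q * p) = 0}"
    have "ideal ?Z class_ring"
      by (auto simp: ideal_class_ring_iff T_def distrib_left lin_ext_add simp flip: mult.assoc)
    moreover have "Poly_Mapping.map \<phi> ` I \<subseteq> ?Z"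
      using T_I \<open>k \<in> K\<close> by auto
    ultimately have "extend_ideal \<phi> I \<subseteq> ?Z"
      unfolding extend_ideal_def by (rule Idl_least)
    then have "T k (1 * p) = 0" using that(1) by blast
    then show ?thesis by simp
  qed
  show ?thesis
    unfolding indep_mod_def
  proof (intro allI impI ballI)
    fix c k
    assume c: "(\<Sum>j\<in>K. pconst (c j) * Poly_Mapping.map \<phi> (f j)) \<in> extend_ideal \<phi> I" and k: "k \<in> K"
    have "0 = (\<Sum>j\<in>K. c j * T k (Poly_Mapping.map \<phi> (f j)))"
      using T_E[OF c k] by (simp add: T_def lin_ext_sum lin_ext_pconst_mult)
    also have "\<dots> = (\<Sum>j\<in>K. c j * \<phi> (if k = j then 1 else 0))"
      using T_map[OF represents_self[OF I K] k] by (intro sum.cong) auto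
    also have "\<dots> = (\<Sum>j\<in>K. if k = j then c j else 0)"
      by (intro sum.cong) auto
    also have "\<dots> = c k"
      using K k by simp
    finally show "c k = 0" ..
  qed
qed

theorem theorem4p1:
  fixes I :: "('n::finite, 'a::field) mpoly set"
    and m :: nat
    and \<phi> :: "'a \<Rightarrow> 'e::field"
  assumes "ideal I class_ring"
    and "quot_fin_dim I"
    and "m \<le> quot_dim I + 1"
    and "field_hom \<phi>"
  shows "ideal (rich_ideal I m) class_ring \<and>
    zero_locus (rich_ideal I m) = {a. rich I m a} \<and>
    (rich_ideal I m = {0} \<or>
      (\<exists>S. (\<forall>p\<in>S. homogeneous_of_degree (quot_dim I + 1 - m) p) \<and>
           rich_ideal I m = Idl\<^bsub>class_ring\<^esub> S)) \<and>
    rich_ideal (extend_ideal \<phi> I) m = extend_ideal \<phi> (rich_ideal I m)"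
proof -
  note I = assms(1) and \<phi> = assms(4)
  define N where "N = quot_dim I"
  obtain bs where bs: "ordered_basis I bs"
    using ordered_basis_exists[OF I assms(2)] by blast
  have "length bs = N"
    unfolding N_def by (rule length_ordered_basis[OF I bs])
  with ordered_basis_coset[OF I bs] obtain f
    where f: "spans_mod I {..<N} f" "indep_mod I {..<N} f"
    by blast
  define M where "M i k j =
    mult_mat I (map (\<lambda>k. I +>\<^bsub>class_ring\<^esub> f k) [0..<N]) (pvar i) $$ (k, j)" for i k j
  have M: "represents I {..<N} f (pvar i * f j) (\<lambda>k. M i k j)" if "j < N" for i j
    unfolding M_def by (rule represents_mult_mat[OF I f that])
  have eq: "rich_ideal I m = Idl\<^bsub>class_ring\<^esub> (minors (N + 1 - m) (pencil N M))"
    by (rule rich_ideal_eq_Idl_pencil[OF I f M])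

  have locus: "a \<in> zero_locus (rich_ideal I m) \<longleftrightarrow> rich I m a" for a
  proof -
    \<comment> \<open>The general matrix evaluated at \<open>a\<close>, which is the matrix of
      multiplication by \<open>lin_form a\<close>.\<close>
    define A where "A = mat N N (\<lambda>(k, j). \<Sum>i\<in>UNIV. a i * M i k j)"
    interpret ev: comm_ring_hom "peval a" by (rule comm_ring_hom_peval)
    have map_A: "map_mat (peval a) (pencil N M) = A"
      by (rule eq_matI) (auto simp: pencil_def A_def ev.hom_sum ev.hom_mult)
    have locus_minors: "a \<in> zero_locus (rich_ideal I m) \<longleftrightarrow> (\<forall>x\<in>minors (N + 1 - m) A. x = 0)"
      unfolding eq zero_locus_Idl map_A[symmetric] minors_map_mat[OF comm_ring_hom_peval]
      by (simp add: zero_locus_def)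
    have rep: "represents I {..<N} f (lin_form a * f j) (\<lambda>k. A $$ (k, j))" if "j < N" for j
    proof -
      have "represents I {..<N} f (\<Sum>i\<in>UNIV. pconst (a i) * (pvar i * f j))
          (\<lambda>k. \<Sum>i\<in>UNIV. a i * M i k j)"
        by (rule represents_sum[OF I M[OF that]])
      then show ?thesis
        using that by (simp add: represents_def A_def lin_form_def sum_distrib_right mult.assoc)
    qed
    have "A \<in> carrier_mat N N" by (simp add: A_def)
    note minors_vanish_iff_quot_dim[OF I f this rep, of "N + 1 - m"]
    \<comment> \<open>The bound \<open>m \<le> N + 1\<close> makes the subtraction exact. At
      \<open>m = 0\<close> there are no minors of size \<open>N + 1\<close>; at
      \<open>m = N + 1\<close> the empty minor is 1.\<close>
    also have "N < N + 1 - m + d \<longleftrightarrow> m \<le> d" for d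
      using assms(3) unfolding N_def[symmetric] by linarith
    finally show ?thesis
      unfolding locus_minors rich_def .
  qed
  have homogeneous: "homogeneous_of_degree (N + 1 - m) p"
    if "p \<in> minors (N + 1 - m) (pencil N M)" for p
  proof (rule homogeneous_minors[OF that])
    fix k j assume "k < dim_row (pencil N M)" "j < dim_col (pencil N M)"
    then show "homogeneous_of_degree 1 (pencil N M $$ (k, j))"
      using homogeneous_of_degree_mult[OF homogeneous_of_degree_pvar homogeneous_of_degree_pconst]
      by (auto simp: pencil_def intro!: homogeneous_of_degree_sum)
  qed
  have extend: "rich_ideal (extend_ideal \<phi> I) m = extend_ideal \<phi> (rich_ideal I m)"
  proof -
    interpret field_hom \<phi> by fact
    have hom: "comm_ring_hom (Poly_Mapping.map \<phi> :: ('n, 'a) mpoly \<Rightarrow> ('n, 'e) mpoly)"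
      by (rule comm_ring_hom_map) unfold_locales
    interpret m: comm_ring_hom "Poly_Mapping.map \<phi> :: ('n, 'a) mpoly \<Rightarrow> ('n, 'e) mpoly"
      by (rule hom)
    have E: "ideal (extend_ideal \<phi> I) class_ring"
      unfolding extend_ideal_def by (rule ideal_Idl)
    \<comment> \<open>Over \<open>E\<close> the images of the \<open>f j\<close> have the
      multiplication matrices \<open>M i\<close> with \<phi> applied to the entries.\<close>
    have "represents (extend_ideal \<phi> I) {..<N} (\<lambda>k. Poly_Mapping.map \<phi> (f k))
        (pvar i * Poly_Mapping.map \<phi> (f j)) (\<lambda>k. \<phi> (M i k j))" if "j < N" for i j
      using represents_extend_ideal[OF \<phi> M[OF that], of i]
      by (simp add: m.hom_mult map_pvar)
    from rich_ideal_eq_Idl_pencil[OF E spans_mod_extend_ideal[OF \<phi> f(1)]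
        indep_mod_extend_ideal[OF \<phi> I _ f] this, of m]
    have "rich_ideal (extend_ideal \<phi> I) m =
        Idl\<^bsub>class_ring\<^esub> (minors (N + 1 - m) (pencil N (\<lambda>i k j. \<phi> (M i k j))))"
      by simp
    also have "pencil N (\<lambda>i k j. \<phi> (M i k j)) = map_mat (Poly_Mapping.map \<phi>) (pencil N M)"
      by (rule eq_matI) (auto simp: pencil_def m.hom_sum m.hom_mult map_pvar map_pconst)
    finally show ?thesis
      unfolding eq extend_ideal_def Idl_image_hom[OF hom] minors_map_mat[OF hom] .
  qed
  show ?thesis
    unfolding N_def[symmetric]
  \<comment> \<open>The generating set is the set of minors itself. For \<open>m = 0\<close> it is
    empty and generates the zero ideal.\<close>
  proof (intro conjI disjI2 exI ballI)
    show "ideal (rich_ideal I m) class_ring"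
      unfolding eq by (rule ideal_Idl)
    show "zero_locus (rich_ideal I m) = {a. rich I m a}"
      using locus by blast
  qed (fact homogeneous eq extend)+
qed

end
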